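(* Let $\mathscr{A}$ be a (not necessarily unital) complex $^*$-algebra and let $f,g$ be representable positive functionals on $\mathscr{A}$. Let $(H_A,\pi_A,\zeta_A)$ and $(H_B,\pi_B,\zeta_B)$ be the GNS triplets induced by $f$ and $g$ respectively, with associated positive operators $A,B:\mathscr{A}\to\bar{\mathscr{A}}^*$, let $$\mathfrak{M}:=\{\zeta\in H_B \mid \exists\,(a_n)_{n\in\mathbb{N}}\subseteq\mathscr{A}:\ (Aa_n\,|\,Aa_n)_A\to0,\ Ba_n\to\zeta \text{ in } H_B\},$$ let $P$ be the orthogonal projection of $H_B$ onto the closed linear subspace $\mathfrak{M}$, and define, for $a\in\mathscr{A}$, $$g_a(a):=(\pi_B(a)(I-P)\zeta_B\,|\,(I-P)\zeta_B)_B,\qquad g_s(a):=(\pi_B(a)P\zeta_B\,|\,P\zeta_B)_B .$$ Then $$g=g_a+g_s,$$ where both $g_a$ and $g_s$ are representable positive functionals, $g_a$ is absolutely continuous with respect to $f$, and $g_s$ and $f$ are mutually singular. Furthermore, $g_a$ is maximal in the following sense: for any representable positive functional $h$ on $\mathscr{A}$, if $h\le g$ and $h\ll f$, then $h\le g_a$.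
   Context: A positive functional on a complex $^*$-algebra $\mathscr{A}$ is a linear functional $f:\mathscr{A}\to\mathbb{C}$ with $f(a^*a)\ge0$ for all $a\in\mathscr{A}$. It is called representable if (i) there is a constant $C\ge0$ with $|f(a)|^2\le C f(a^*a)$ for all $a\in\mathscr{A}$, and (ii) for every $a\in\mathscr{A}$ there is $\lambda_a\ge0$ with $f(b^*a^*ab)\le\lambda_a f(b^*b)$ for all $b\in\mathscr{A}$. (Equivalently: there are a Hilbert space $H$, a $^*$-representation $\pi$ of $\mathscr{A}$ by bounded operators on $H$ and a cyclic vector $\zeta\in H$ with $f(a)=(\pi(a)\zeta\,|\,\zeta)$ for all $a$.) Order: for positive functionals, $h\le g$ means $h(a^*a)\le g(a^*a)$ for all $a\in\mathscr{A}$. Absolute continuity: $g$ is absolutely continuous with respect to $f$, written $g\ll f$, if for any sequence $(a_n)_{n\in\mathbb{N}}$ in $\mathscr{A}$, $f(a_n^*a_n)\to0$ and $g((a_n-a_m)^*(a_n-a_m))\to0$ (as $n,m\to\infty$) imply $g(a_n^*a_n)\to0$. Singularity: representable positive functionals $f$ and $g$ are mutually singular if, for any representable positive functional $h$, $h\le f$ and $h\le g$ imply $h=0$. GNS construction. $\bar{\mathscr{A}}^*$ denotes the vector space of all antilinear functionals $\mathscr{A}\to\mathbb{C}$. Given a representable positive functional $f$, its associated positive operator is the linear map $A:\mathscr{A}\to\bar{\mathscr{A}}^*$, $(Aa)(x):=f(x^*a)$. The range $\operatorname{ran}A$ carries the well-defined inner product $(Aa\,|\,Ab)_A:=f(b^*a)$,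 and $H_A$ is its Hilbert space completion (inner products are linear in the first variable). For $x\in\mathscr{A}$, $\pi_A(x)$ is the bounded operator on $H_A$ that is the continuous extension of $Aa\mapsto A(xa)$; $\pi_A$ is a $^*$-representation of $\mathscr{A}$ on $H_A$. The vector $\zeta_A\in H_A$ is the unique vector with $f(a)=(Aa\,|\,\zeta_A)_A$ for all $a\in\mathscr{A}$; it is cyclic for $\pi_A$, and $\pi_A(a)\zeta_A=Aa$, $f(a)=(\pi_A(a)\zeta_A\,|\,\zeta_A)_A$ for all $a\in\mathscr{A}$. The triplet $(H_B,\pi_B,\zeta_B)$, operator $B$, and inner product $(\cdot\,|\,\cdot)_B$ are obtained in the same way from $g$. In the notation $g_a$, $g_s$ the subscripts $a$ and $s$ are mere labels ("absolutely continuous", "singular") and not elements of $\mathscr{A}$. *)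

theory Defs
  imports Complex_Main "HOL-Library.Complex_Order" "HOL-Library.Function_Algebras"
    "HOL-Library.FuncSet"
begin

section \<open>Complex vector spaces and star-algebras\<close>

class complex_vector = ab_group_add +
  fixes scaleC :: "complex \<Rightarrow> 'a \<Rightarrow> 'a" (infixr "*\<^sub>C" 75)
  assumes scaleC_add_right: "c *\<^sub>C (x + y) = c *\<^sub>C x + c *\<^sub>C y"
    and scaleC_add_left: "(c + d) *\<^sub>C x = c *\<^sub>C x + d *\<^sub>C x"
    and scaleC_scaleC: "c *\<^sub>C d *\<^sub>C x = (c * d) *\<^sub>C x"
    and scaleC_one: "1 *\<^sub>C x = x"

global_interpretation cvec: vector_space "scaleC :: complex \<Rightarrow> 'a \<Rightarrow> 'a :: complex_vector"
  by standard (fact scaleC_add_right scaleC_add_left scaleC_scaleC scaleC_one)+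

instantiation complex :: complex_vector
begin

definition scaleC_complex_def: "c *\<^sub>C (z :: complex) = c * z"

instance
  by standard (simp_all add: scaleC_complex_def algebra_simps)

end

instantiation "fun" :: (type, complex_vector) complex_vector
begin

definition scaleC_fun_def: "c *\<^sub>C (\<phi> :: 'a \<Rightarrow> 'b) = (\<lambda>x. c *\<^sub>C \<phi> x)"

instance
  by standard
    (simp_all add: scaleC_fun_def fun_eq_iff scaleC_add_right scaleC_add_left scaleC_scaleC scaleC_one)

end

text \<open>The class \<^class>\<open>ring\<close> does not require a unit.\<close>

class star_algebra = complex_vector + ring +
  fixes star :: "'a \<Rightarrow> 'a" ("_\<^sup>\<star>" [1000] 999)
  assumes mult_scaleC_left: "(c *\<^sub>C a) * b = c *\<^sub>C (a * b)"
    and mult_scaleC_right: "a * (c *\<^sub>C b) = c *\<^sub>C (a * b)"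
    and star_star: "(a\<^sup>\<star>)\<^sup>\<star> = a"
    and star_add: "(a + b)\<^sup>\<star> = a\<^sup>\<star> + b\<^sup>\<star>"
    and star_scaleC: "(c *\<^sub>C a)\<^sup>\<star> = cnj c *\<^sub>C a\<^sup>\<star>"
    and star_mult: "(a * b)\<^sup>\<star> = b\<^sup>\<star> * a\<^sup>\<star>"


section \<open>Positive functionals\<close>

text \<open>
  The order on \<^typ>\<open>complex\<close> is the one of \<^theory>\<open>HOL-Library.Complex_Order\<close>:
  \<open>z \<le> w\<close> means \<open>Re z \<le> Re w\<close> and \<open>Im z = Im w\<close>; so \<open>0 \<le> z\<close> says that \<open>z\<close> is real and nonnegative.
\<close>

definition positive_functional :: "('a::star_algebra \<Rightarrow> complex) \<Rightarrow> bool" where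
  "positive_functional f \<longleftrightarrow>
     Vector_Spaces.linear (*\<^sub>C) (*\<^sub>C) f \<and> (\<forall>a. 0 \<le> f (a\<^sup>\<star> * a))"

definition representable :: "('a::star_algebra \<Rightarrow> complex) \<Rightarrow> bool" where
  "representable f \<longleftrightarrow> positive_functional f \<and>
     (\<exists>C::real. 0 \<le> C \<and> (\<forall>a. complex_of_real ((cmod (f a))\<^sup>2) \<le> complex_of_real C * f (a\<^sup>\<star> * a))) \<and>
     (\<forall>a. \<exists>l::real. 0 \<le> l \<and> (\<forall>b. f (b\<^sup>\<star> * a\<^sup>\<star> * a * b) \<le> complex_of_real l * f (b\<^sup>\<star> * b)))"

text \<open>Not to be confused with the pointwise order on functions.\<close>

definition pos_le :: "('a::star_algebra \<Rightarrow> complex) \<Rightarrow> ('a \<Rightarrow> complex) \<Rightarrow> bool"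
    (infix "\<preceq>" 50) where
  "h \<preceq> g \<longleftrightarrow> (\<forall>a. h (a\<^sup>\<star> * a) \<le> g (a\<^sup>\<star> * a))"

definition abs_continuous :: "('a::star_algebra \<Rightarrow> complex) \<Rightarrow> ('a \<Rightarrow> complex) \<Rightarrow> bool"
    (infix "\<lless>" 50) where
  "g \<lless> f \<longleftrightarrow> (\<forall>a::nat \<Rightarrow> 'a.
     (\<lambda>n. f ((a n)\<^sup>\<star> * a n)) \<longlonglongrightarrow> 0 \<longrightarrow>
     ((\<lambda>(n, m). g ((a n - a m)\<^sup>\<star> * (a n - a m))) \<longlongrightarrow> 0) (sequentially \<times>\<^sub>F sequentially) \<longrightarrow>
     (\<lambda>n. g ((a n)\<^sup>\<star> * a n)) \<longlonglongrightarrow> 0)"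

definition mutually_singular :: "('a::star_algebra \<Rightarrow> complex) \<Rightarrow> ('a \<Rightarrow> complex) \<Rightarrow> bool" where
  "mutually_singular f g \<longleftrightarrow> (\<forall>h. representable h \<longrightarrow> h \<preceq> f \<longrightarrow> h \<preceq> g \<longrightarrow> h = 0)"


section \<open>Hilbert spaces and completions\<close>

text \<open>
  A Hilbert space is given by its carrier \<open>H\<close>, a linear subspace of an ambient complex vector
  space, together with an inner product, which is only meaningful on \<open>H\<close>.  A carrier is needed
  because the completion below depends on a functional.
\<close>

locale cinner_space =
  fixes H :: "'h::complex_vector set" and ip :: "'h \<Rightarrow> 'h \<Rightarrow> complex"
  assumes subspace: "cvec.subspace H"
    and ip_add_left: "\<lbrakk>u \<in> H; v \<in> H; w \<in> H\<rbrakk> \<Longrightarrow> ip (u + v) w = ip u w + ip v w"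
    and ip_scaleC_left: "\<lbrakk>u \<in> H; w \<in> H\<rbrakk> \<Longrightarrow> ip (c *\<^sub>C u) w = c * ip u w"
    and ip_commute: "\<lbrakk>u \<in> H; v \<in> H\<rbrakk> \<Longrightarrow> ip u v = cnj (ip v u)"
    and ip_ge_zero: "u \<in> H \<Longrightarrow> 0 \<le> ip u u"
    and ip_eq_zero: "\<lbrakk>u \<in> H; ip u u = 0\<rbrakk> \<Longrightarrow> u = 0"

definition ip_norm :: "('h \<Rightarrow> 'h \<Rightarrow> complex) \<Rightarrow> 'h \<Rightarrow> real" where
  "ip_norm ip u = sqrt (Re (ip u u))"

locale chilbert_space = cinner_space +
  assumes complete:
    "\<lbrakk>\<And>n. u n \<in> H; \<And>e. e > 0 \<Longrightarrow> \<exists>N. \<forall>m\<ge>N. \<forall>n\<ge>N. ip_norm ip (u m - u n) < e\<rbrakk>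
      \<Longrightarrow> \<exists>v\<in>H. (\<lambda>n::nat. ip_norm ip (u n - v)) \<longlonglongrightarrow> 0"

definition hilbert_completion ::
  "'v::complex_vector set \<Rightarrow> ('v \<Rightarrow> 'v \<Rightarrow> complex) \<Rightarrow>
   'h::complex_vector set \<Rightarrow> ('h \<Rightarrow> 'h \<Rightarrow> complex) \<Rightarrow> ('v \<Rightarrow> 'h) \<Rightarrow> bool" where
  "hilbert_completion V ipV H ip J \<longleftrightarrow>
     cinner_space V ipV \<and> chilbert_space H ip \<and> J \<in> V \<rightarrow> H \<and>
     (\<forall>u\<in>V. \<forall>v\<in>V. J (u + v) = J u + J v) \<and>
     (\<forall>c. \<forall>u\<in>V. J (c *\<^sub>C u) = c *\<^sub>C J u) \<and>
     (\<forall>u\<in>V. \<forall>v\<in>V. ip (J u) (J v) = ipV u v) \<and>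
     (\<forall>h\<in>H. \<forall>e>0. \<exists>v\<in>V. ip_norm ip (J v - h) < e)"

definition bounded_operator ::
  "'h::complex_vector set \<Rightarrow> ('h \<Rightarrow> 'h \<Rightarrow> complex) \<Rightarrow> ('h \<Rightarrow> 'h) \<Rightarrow> bool" where
  "bounded_operator H ip T \<longleftrightarrow> T \<in> H \<rightarrow> H \<and>
     (\<forall>u\<in>H. \<forall>v\<in>H. T (u + v) = T u + T v) \<and>
     (\<forall>c. \<forall>u\<in>H. T (c *\<^sub>C u) = c *\<^sub>C T u) \<and>
     (\<exists>K. \<forall>u\<in>H. ip_norm ip (T u) \<le> K * ip_norm ip u)"

definition orth_projection ::
  "'h::complex_vector set \<Rightarrow> ('h \<Rightarrow> 'h \<Rightarrow> complex) \<Rightarrow> 'h \<Rightarrow> 'h" where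
  "orth_projection M ip u = (THE p. p \<in> M \<and> (\<forall>m\<in>M. ip (u - p) m = 0))"


section \<open>The GNS construction\<close>

text \<open>
  \<open>gns_op f\<close> is the positive operator associated with \<open>f\<close>; its values are antilinear functionals.
  In the rest of this section \<open>(H, ip, J)\<close> stands for a Hilbert space completion of
  \<open>range (gns_op g)\<close> with respect to \<open>gns_inner g\<close>.
\<close>

definition gns_op :: "('a::star_algebra \<Rightarrow> complex) \<Rightarrow> 'a \<Rightarrow> ('a \<Rightarrow> complex)" where
  "gns_op f a = (\<lambda>x. f (x\<^sup>\<star> * a))"

definition gns_inner ::
  "('a::star_algebra \<Rightarrow> complex) \<Rightarrow> ('a \<Rightarrow> complex) \<Rightarrow> ('a \<Rightarrow> complex) \<Rightarrow> complex" where
  "gns_inner f \<phi> \<psi> = (THE z. \<exists>a b. \<phi> = gns_op f a \<and> \<psi> = gns_op f b \<and> z = f (b\<^sup>\<star> * a))"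

abbreviation gns_completion ::
  "('a::star_algebra \<Rightarrow> complex) \<Rightarrow>
   'h::complex_vector set \<Rightarrow> ('h \<Rightarrow> 'h \<Rightarrow> complex) \<Rightarrow> (('a \<Rightarrow> complex) \<Rightarrow> 'h) \<Rightarrow> bool" where
  "gns_completion g H ip J \<equiv> hilbert_completion (range (gns_op g)) (gns_inner g) H ip J"

definition gns_rep ::
  "('a::star_algebra \<Rightarrow> complex) \<Rightarrow>
   'h::complex_vector set \<Rightarrow> ('h \<Rightarrow> 'h \<Rightarrow> complex) \<Rightarrow> (('a \<Rightarrow> complex) \<Rightarrow> 'h) \<Rightarrow> 'a \<Rightarrow> 'h \<Rightarrow> 'h" where
  "gns_rep g H ip J x = (THE T. T \<in> extensional H \<and> bounded_operator H ip T \<and>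
     (\<forall>a. T (J (gns_op g a)) = J (gns_op g (x * a))))"

definition gns_vector ::
  "('a::star_algebra \<Rightarrow> complex) \<Rightarrow>
   'h::complex_vector set \<Rightarrow> ('h \<Rightarrow> 'h \<Rightarrow> complex) \<Rightarrow> (('a \<Rightarrow> complex) \<Rightarrow> 'h) \<Rightarrow> 'h" where
  "gns_vector g H ip J = (THE z. z \<in> H \<and> (\<forall>a. g a = ip (J (gns_op g a)) z))"


section \<open>The Lebesgue decomposition\<close>

definition sing_subspace ::
  "('a::star_algebra \<Rightarrow> complex) \<Rightarrow> ('a \<Rightarrow> complex) \<Rightarrow>
   'h::complex_vector set \<Rightarrow> ('h \<Rightarrow> 'h \<Rightarrow> complex) \<Rightarrow> (('a \<Rightarrow> complex) \<Rightarrow> 'h) \<Rightarrow> 'h set" where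
  "sing_subspace f g H ip J = {z \<in> H. \<exists>a::nat \<Rightarrow> 'a.
     (\<lambda>n. gns_inner f (gns_op f (a n)) (gns_op f (a n))) \<longlonglongrightarrow> 0 \<and>
     (\<lambda>n. ip_norm ip (J (gns_op g (a n)) - z)) \<longlonglongrightarrow> 0}"

definition sing_part ::
  "('a::star_algebra \<Rightarrow> complex) \<Rightarrow> ('a \<Rightarrow> complex) \<Rightarrow>
   'h::complex_vector set \<Rightarrow> ('h \<Rightarrow> 'h \<Rightarrow> complex) \<Rightarrow> (('a \<Rightarrow> complex) \<Rightarrow> 'h) \<Rightarrow> 'a \<Rightarrow> complex" where
  "sing_part f g H ip J a =
     (let z = gns_vector g H ip J; P = orth_projection (sing_subspace f g H ip J) ip
      in ip (gns_rep g H ip J a (P z)) (P z))"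

definition ac_part ::
  "('a::star_algebra \<Rightarrow> complex) \<Rightarrow> ('a \<Rightarrow> complex) \<Rightarrow>
   'h::complex_vector set \<Rightarrow> ('h \<Rightarrow> 'h \<Rightarrow> complex) \<Rightarrow> (('a \<Rightarrow> complex) \<Rightarrow> 'h) \<Rightarrow> 'a \<Rightarrow> complex" where
  "ac_part f g H ip J a =
     (let z = gns_vector g H ip J; P = orth_projection (sing_subspace f g H ip J) ip
      in ip (gns_rep g H ip J a (z - P z)) (z - P z))"


section \<open>Existence of the completion\<close>

text \<open>
  Not needed to state the theorem: this shows that \<^const>\<open>gns_completion\<close> can always be satisfied,
  with a carrier consisting of functionals on the algebra.  For a positive semidefinite form \<open>s\<close>,
  the completion \<open>H\<close> of \<open>range s\<close> consists of the pointwise limits of sequences \<open>s (a n)\<close> with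
  \<open>a\<close> Cauchy for the seminorm of \<open>s\<close>.
\<close>

locale psd_form =
  fixes s :: "'a::complex_vector \<Rightarrow> 'a \<Rightarrow> complex"
  assumes add_left: "s (a + b) c = s a c + s b c"
    and scale_left: "s (r *\<^sub>C a) b = r * s a b"
    and commute: "s a b = cnj (s b a)"
    and nonneg: "0 \<le> s a a"
begin

definition D where "D a = sqrt (Re (s a a))"

lemma add_right: "s a (b + c) = s a b + s a c"
  using commute[of a "b+c"] commute[of a b] commute[of a c] by (simp add: add_left)

lemma scale_right: "s a (c *\<^sub>C b) = cnj c * s a b"
  using commute[of a "c *\<^sub>C b"] commute[of a b] by (simp add: scale_left)

lemma zero_left: "s 0 b = 0"
  using add_left[of 0 0 b] by simp

lemma minus_left: "s (- a) b = - s a b"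
  using add_left[of "-a" a b] by (simp add: zero_left add_eq_0_iff)

lemma diff_left: "s (a - b) c = s a c - s b c"
  using add_left[of a "-b" c] by (simp add: minus_left)

lemma diff_right: "s a (b - c) = s a b - s a c"
  using commute[of a "b-c"] commute[of a b] commute[of a c] by (simp add: diff_left)

lemma D_ge: "0 \<le> D a"
  using nonneg[of a] by (simp add: D_def less_eq_complex_def)

lemma D_square: "s a a = of_real ((D a)\<^sup>2)"
  using nonneg[of a] by (simp add: D_def less_eq_complex_def complex_eq_iff)

lemma D_minus: "D (a - b) = D (b - a)"
  by (simp add: D_def diff_left diff_right)

lemma cs: "cmod (s a b) \<le> D a * D b"
proof -
  have main: "cmod (s a b) ^ 2 \<le> (D a)\<^sup>2 * (D b)\<^sup>2"
  proof -
    define w where "w = s a b"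
    have ex: "0 \<le> (D a)\<^sup>2 - 2 * t * (cmod w)\<^sup>2 + t\<^sup>2 * (cmod w)\<^sup>2 * (D b)\<^sup>2" for t :: real
    proof -
      let ?c = "of_real t * w"
      have ww: "w * cnj w = of_real ((cmod w)\<^sup>2)" by (simp only: complex_norm_square)
      have "s (a - ?c *\<^sub>C b) (a - ?c *\<^sub>C b)
          = s a a - cnj ?c * s a b - ?c * s b a + ?c * cnj ?c * s b b"
        by (simp add: diff_left diff_right scale_left scale_right algebra_simps)
      also have "\<dots> = s a a - of_real (2 * t) * (w * cnj w) + of_real (t\<^sup>2) * (w * cnj w) * s b b"
        using commute[of b a] by (simp add: w_def algebra_simps power2_eq_square)
      also have "\<dots> = of_real ((D a)\<^sup>2 - 2 * t * (cmod w)\<^sup>2 + t\<^sup>2 * (cmod w)\<^sup>2 * (D b)\<^sup>2)"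
        by (simp only: ww D_square) simp
      finally show ?thesis
        using nonneg[of "a - ?c *\<^sub>C b"] by (simp add: less_eq_complex_def)
    qed
    show ?thesis
    proof (cases "w = 0")
      case True then show ?thesis by (simp add: w_def)
    next
      case False
      then have wp: "(cmod w)\<^sup>2 > 0" by simp
      show ?thesis
      proof (cases "D b = 0")
        case True
        have "0 \<le> (D a)\<^sup>2 - 2 * (((D a)\<^sup>2 + 1) / (2 * (cmod w)\<^sup>2)) * (cmod w)\<^sup>2"
          using ex[of "((D a)\<^sup>2 + 1) / (2 * (cmod w)\<^sup>2)"] True by simp
        then show ?thesis using wp by (simp add: field_simps)
      next
        case False
        then have bp: "(D b)\<^sup>2 > 0" by simp
        have "0 \<le> (D a)\<^sup>2 - 2 * (1 / (D b)\<^sup>2) * (cmod w)\<^sup>2 + (1 / (D b)\<^sup>2)\<^sup>2 * (cmod w)\<^sup>2 * (D b)\<^sup>2"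
          by (rule ex)
        also have "\<dots> = (D a)\<^sup>2 - (cmod w)\<^sup>2 / (D b)\<^sup>2"
          using False by (simp add: field_simps power2_eq_square)
        finally show ?thesis using bp by (simp add: field_simps w_def)
      qed
    qed
  qed
  then have "cmod (s a b) ^ 2 \<le> (D a * D b)\<^sup>2" by (simp add: power_mult_distrib)
  then show ?thesis by (rule power2_le_imp_le) (simp add: D_ge)
qed

lemma D_add: "D (a + b) \<le> D a + D b"
proof (rule power2_le_imp_le)
  have "of_real ((D (a + b))\<^sup>2) = s a a + s b b + (s a b + s b a)"
    by (simp only: D_square[symmetric] add_left add_right) simp
  also have "s b a = cnj (s a b)" by (rule commute)
  also have "s a b + cnj (s a b) = of_real (2 * Re (s a b))" by (simp add: complex_add_cnj)
  finally have "(D (a + b))\<^sup>2 = (D a)\<^sup>2 + (D b)\<^sup>2 + 2 * Re (s a b)"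
    by (simp only: D_square of_real_add[symmetric] of_real_eq_iff)
  also have "Re (s a b) \<le> D a * D b"
    using cs[of a b] complex_Re_le_cmod[of "s a b"] by linarith
  finally show "(D (a + b))\<^sup>2 \<le> (D a + D b)\<^sup>2" by (simp add: power2_sum)
qed (simp add: D_ge)

lemma D_tri: "D (a - c) \<le> D (a - b) + D (b - c)"
  using D_add[of "a - b" "b - c"] by simp

lemma D_tri2: "D a \<le> D (a - b) + D b"
  using D_add[of "a - b" "b"] by simp

lemma D_scale: "D (c *\<^sub>C a) = cmod c * D a"
proof -
  have "s (c *\<^sub>C a) (c *\<^sub>C a) = of_real ((cmod c)\<^sup>2 * (D a)\<^sup>2)"
    unfolding scale_left scale_right D_square[of a] of_real_mult complex_norm_square
    by (simp only: mult_ac)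
  then have "D (c *\<^sub>C a) = sqrt ((cmod c * D a)\<^sup>2)"
    by (simp only: D_def[of "c *\<^sub>C a"] Re_complex_of_real power_mult_distrib)
  then show ?thesis using D_ge by simp
qed

definition cau :: "(nat \<Rightarrow> 'a) \<Rightarrow> bool" where
  "cau a \<longleftrightarrow> (\<forall>e>0. \<exists>N. \<forall>m\<ge>N. \<forall>n\<ge>N. D (a m - a n) < e)"

lemma cau_add: assumes "cau a" "cau b" shows "cau (\<lambda>n. a n + b n)"
  unfolding cau_def
proof (intro allI impI)
  fix e :: real assume "e > 0"
  then have e: "e / 2 > 0" by simp
  obtain N1 where N1: "\<forall>m\<ge>N1. \<forall>n\<ge>N1. D (a m - a n) < e / 2" using assms(1) e unfolding cau_def by blast
  obtain N2 where N2: "\<forall>m\<ge>N2. \<forall>n\<ge>N2. D (b m - b n) < e / 2" using assms(2) e unfolding cau_def by blast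
  have "D (a m + b m - (a n + b n)) < e" if "m \<ge> max N1 N2" "n \<ge> max N1 N2" for m n
  proof -
    have "D (a m - a n) < e / 2" "D (b m - b n) < e / 2" using N1 N2 that by simp_all
    moreover have "D (a m + b m - (a n + b n)) \<le> D (a m - a n) + D (b m - b n)"
      using D_add[of "a m - a n" "b m - b n"] by (simp add: algebra_simps)
    ultimately show ?thesis by simp
  qed
  then show "\<exists>N. \<forall>m\<ge>N. \<forall>n\<ge>N. D (a m + b m - (a n + b n)) < e" by blast
qed

lemma cau_scale: assumes "cau a" shows "cau (\<lambda>n. c *\<^sub>C a n)"
  unfolding cau_def
proof (intro allI impI)
  fix e :: real assume e: "e > 0"
  have p: "cmod c + 1 > 0" using norm_ge_zero[of c] by linarith
  then obtain N where N: "\<forall>m\<ge>N. \<forall>n\<ge>N. D (a m - a n) < e / (cmod c + 1)"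
    using assms e unfolding cau_def by (meson divide_pos_pos)
  have "D (c *\<^sub>C a m - c *\<^sub>C a n) < e" if "m \<ge> N" "n \<ge> N" for m n
  proof -
    have "D (c *\<^sub>C a m - c *\<^sub>C a n) = cmod c * D (a m - a n)"
      by (simp add: D_scale[symmetric] cvec.scale_right_diff_distrib)
    also have "\<dots> \<le> (cmod c + 1) * D (a m - a n)" using D_ge by (simp add: mult_right_mono)
    also have "\<dots> < e" using N that p by (simp add: field_simps)
    finally show ?thesis .
  qed
  then show "\<exists>N. \<forall>m\<ge>N. \<forall>n\<ge>N. D (c *\<^sub>C a m - c *\<^sub>C a n) < e" by blast
qed

lemma cau_const: "cau (\<lambda>n. a)"
  unfolding cau_def D_def by (auto simp: zero_left)

lemma cau_diff: assumes "cau a" "cau b" shows "cau (\<lambda>n. a n - b n)"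
  using cau_add[OF assms(1) cau_scale[OF assms(2), of "-1"]] by (simp add: cvec.scale_minus_left scaleC_one)

lemma cau_bdd: assumes "cau a" shows "\<exists>K>0. \<forall>n. D (a n) \<le> K"
proof -
  obtain N where N: "\<forall>m\<ge>N. \<forall>n\<ge>N. D (a m - a n) < 1"
    using assms unfolding cau_def by (meson zero_less_one)
  define K where "K = 1 + (\<Sum>i\<le>N. D (a i))"
  have s0: "0 \<le> (\<Sum>i\<le>N. D (a i))" by (simp add: D_ge sum_nonneg)
  have "D (a n) \<le> K" for n
  proof (cases "n \<le> N")
    case True
    then have "D (a n) \<le> (\<Sum>i\<le>N. D (a i))" by (intro member_le_sum) (auto simp: D_ge)
    then show ?thesis by (simp add: K_def)
  next
    case False
    have "D (a N) \<le> (\<Sum>i\<le>N. D (a i))" by (intro member_le_sum) (auto simp: D_ge)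
    moreover have "D (a n - a N) < 1" using N False by simp
    ultimately show ?thesis using D_tri2[of "a n" "a N"] by (simp add: K_def)
  qed
  moreover have "K > 0" using s0 by (simp add: K_def)
  ultimately show ?thesis by blast
qed

lemma cau_conv: assumes "cau a" "cau b" shows "convergent (\<lambda>n. s (a n) (b n))"
proof -
  obtain K where K: "K > 0" "\<forall>n. D (a n) \<le> K" using cau_bdd[OF assms(1)] by blast
  obtain L where L: "L > 0" "\<forall>n. D (b n) \<le> L" using cau_bdd[OF assms(2)] by blast
  have "Cauchy (\<lambda>n. s (a n) (b n))"
  proof (rule CauchyI)
    fix e :: real assume e: "0 < e"
    obtain N1 where N1: "\<forall>m\<ge>N1. \<forall>n\<ge>N1. D (a m - a n) < e / (2 * L)"
      using assms(1) e L(1) unfolding cau_def by (meson divide_pos_pos mult_pos_pos zero_less_numeral)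
    obtain N2 where N2: "\<forall>m\<ge>N2. \<forall>n\<ge>N2. D (b m - b n) < e / (2 * K)"
      using assms(2) e K(1) unfolding cau_def by (meson divide_pos_pos mult_pos_pos zero_less_numeral)
    have "cmod (s (a m) (b m) - s (a n) (b n)) < e" if "m \<ge> max N1 N2" "n \<ge> max N1 N2" for m n
    proof -
      have "s (a m) (b m) - s (a n) (b n) = s (a m - a n) (b m) + s (a n) (b m - b n)"
        by (simp add: diff_left diff_right)
      then have "cmod (s (a m) (b m) - s (a n) (b n)) \<le> D (a m - a n) * D (b m) + D (a n) * D (b m - b n)"
        using cs[of "a m - a n" "b m"] cs[of "a n" "b m - b n"]
        by (smt (verit) norm_triangle_ineq)
      also have "D (a m - a n) * D (b m) \<le> D (a m - a n) * L" using L D_ge by (simp add: mult_left_mono)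
      also have "D (a n) * D (b m - b n) \<le> K * D (b m - b n)" using K D_ge by (simp add: mult_right_mono)
      also have "D (a m - a n) * L < e / 2" using N1 that L by (simp add: field_simps)
      also have "K * D (b m - b n) < e / 2" using N2 that K by (simp add: field_simps)
      finally show ?thesis by simp
    qed
    then show "\<exists>M. \<forall>m\<ge>M. \<forall>n\<ge>M. norm (s (a m) (b m) - s (a n) (b n)) < e" by blast
  qed
  then show ?thesis by (rule Cauchy_convergent)
qed

definition rep :: "(nat \<Rightarrow> 'a) \<Rightarrow> ('a \<Rightarrow> complex) \<Rightarrow> bool" where
  "rep a \<phi> \<longleftrightarrow> cau a \<and> (\<forall>x. (\<lambda>n. s (a n) x) \<longlonglongrightarrow> \<phi> x)"

definition H where "H = {\<phi>. \<exists>a. rep a \<phi>}"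

definition ip where
  "ip \<phi> \<psi> = (THE z. \<exists>a b. rep a \<phi> \<and> rep b \<psi> \<and> (\<lambda>n. s (a n) (b n)) \<longlonglongrightarrow> z)"

lemma rep_ex: assumes "cau a" obtains \<phi> where "rep a \<phi>"
  using cau_conv[OF assms cau_const] assms unfolding convergent_def rep_def by metis

lemma rep_const: "rep (\<lambda>n. a) (s a)"
  by (simp add: rep_def cau_const)

lemma rep_add: "rep a \<phi> \<Longrightarrow> rep b \<psi> \<Longrightarrow> rep (\<lambda>n. a n + b n) (\<phi> + \<psi>)"
  by (auto simp: rep_def cau_add add_left intro: tendsto_add)

lemma rep_scale: "rep a \<phi> \<Longrightarrow> rep (\<lambda>n. c *\<^sub>C a n) (c *\<^sub>C \<phi>)"
  by (auto simp: rep_def cau_scale scale_left scaleC_fun_def scaleC_complex_def intro: tendsto_mult_left)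

lemma rep_diff: "rep a \<phi> \<Longrightarrow> rep b \<psi> \<Longrightarrow> rep (\<lambda>n. a n - b n) (\<phi> - \<psi>)"
  by (auto simp: rep_def cau_diff diff_left intro: tendsto_diff)

lemma rep_zero: assumes "rep c 0" "cau b" shows "(\<lambda>n. s (c n) (b n)) \<longlonglongrightarrow> 0"
proof (rule LIMSEQ_I)
  fix e :: real assume e: "0 < e"
  have c: "cau c" using assms by (simp add: rep_def)
  obtain K where K: "K > 0" "\<forall>n. D (c n) \<le> K" using cau_bdd[OF c] by blast
  obtain N where N: "\<forall>m\<ge>N. \<forall>n\<ge>N. D (b m - b n) < e / (2 * K)"
    using assms(2) e K(1) unfolding cau_def by (meson divide_pos_pos mult_pos_pos zero_less_numeral)
  have "(\<lambda>n. s (c n) (b N)) \<longlonglongrightarrow> 0" using assms(1) by (simp add: rep_def)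
  then obtain M where M: "\<forall>n\<ge>M. cmod (s (c n) (b N)) < e / 2"
    using LIMSEQ_D[of _ 0 "e / 2"] e by fastforce
  have "cmod (s (c n) (b n) - 0) < e" if "n \<ge> max M N" for n
  proof -
    have "s (c n) (b n) = s (c n) (b n - b N) + s (c n) (b N)" by (simp add: diff_right)
    then have "cmod (s (c n) (b n)) \<le> D (c n) * D (b n - b N) + cmod (s (c n) (b N))"
      using cs[of "c n" "b n - b N"] by (smt (verit) norm_triangle_ineq)
    also have "D (c n) * D (b n - b N) \<le> K * D (b n - b N)" using K D_ge by (simp add: mult_right_mono)
    also have "K * D (b n - b N) < e / 2" using N that K by (simp add: field_simps)
    also have "cmod (s (c n) (b N)) < e / 2" using M that by simp
    finally show ?thesis by simp
  qed
  then show "\<exists>M. \<forall>n\<ge>M. cmod (s (c n) (b n) - 0) < e" by blast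
qed

lemma rep_unique:
  assumes "rep a \<phi>" "rep a' \<phi>" "rep b \<psi>" "rep b' \<psi>"
    and "(\<lambda>n. s (a n) (b n)) \<longlonglongrightarrow> z" "(\<lambda>n. s (a' n) (b' n)) \<longlonglongrightarrow> z'"
  shows "z = z'"
proof -
  have 1: "rep (\<lambda>n. a n - a' n) 0" "rep (\<lambda>n. b n - b' n) 0"
    using rep_diff[OF assms(1,2)] rep_diff[OF assms(3,4)] by simp_all
  have "(\<lambda>n. s (a n - a' n) (b n)) \<longlonglongrightarrow> 0"
    using rep_zero[OF 1(1)] assms(3) by (simp add: rep_def)
  moreover have "(\<lambda>n. cnj (s (b n - b' n) (a' n))) \<longlonglongrightarrow> cnj 0"
    by (intro tendsto_cnj rep_zero[OF 1(2)]) (use assms(2) in \<open>simp add: rep_def\<close>)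
  ultimately have "(\<lambda>n. s (a n - a' n) (b n) + cnj (s (b n - b' n) (a' n))) \<longlonglongrightarrow> 0 + cnj 0"
    by (rule tendsto_add)
  moreover have "s (a n - a' n) (b n) + cnj (s (b n - b' n) (a' n)) = s (a n) (b n) - s (a' n) (b' n)" for n
    using commute[of "b n" "a' n"] commute[of "b' n" "a' n"] by (simp add: diff_left diff_right)
  ultimately have "(\<lambda>n. s (a n) (b n) - s (a' n) (b' n)) \<longlonglongrightarrow> 0" by simp
  then have "z - z' = 0" by (rule LIMSEQ_unique[OF tendsto_diff[OF assms(5,6)]])
  then show ?thesis by simp
qed

lemma ip_lim: assumes "rep a \<phi>" "rep b \<psi>" shows "(\<lambda>n. s (a n) (b n)) \<longlonglongrightarrow> ip \<phi> \<psi>"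
proof -
  obtain z where z: "(\<lambda>n. s (a n) (b n)) \<longlonglongrightarrow> z"
    using cau_conv assms unfolding rep_def convergent_def by blast
  have "ip \<phi> \<psi> = z"
    unfolding ip_def by (rule the_equality) (use z assms rep_unique in blast)+
  with z show ?thesis by simp
qed

lemma ip_const: "ip (s a) (s b) = s a b"
  using LIMSEQ_unique[OF ip_lim[OF rep_const rep_const], of a b "s a b"] by simp

lemma cinner_H: "cinner_space H ip"
proof
  show "cvec.subspace H"
    unfolding cvec.subspace_def
  proof (intro conjI ballI allI)
    have "s 0 = 0" by (simp add: fun_eq_iff zero_left)
    then show "0 \<in> H" using rep_const[of 0] unfolding H_def by auto
  next
    fix u v assume "u \<in> H" "v \<in> H"
    then show "u + v \<in> H" unfolding H_def using rep_add by blast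
  next
    fix c u assume "u \<in> H"
    then show "c *\<^sub>C u \<in> H" unfolding H_def using rep_scale by blast
  qed
next
  fix u v w assume "u \<in> H" "v \<in> H" "w \<in> H"
  then obtain a b c where r: "rep a u" "rep b v" "rep c w" by (auto simp: H_def)
  show "ip (u + v) w = ip u w + ip v w"
    using LIMSEQ_unique[OF ip_lim[OF rep_add[OF r(1,2)] r(3)]]
      tendsto_add[OF ip_lim[OF r(1,3)] ip_lim[OF r(2,3)]] by (simp add: add_left)
next
  fix u w c assume "u \<in> H" "w \<in> H"
  then obtain a b where r: "rep a u" "rep b w" by (auto simp: H_def)
  show "ip (c *\<^sub>C u) w = c * ip u w"
    using LIMSEQ_unique[OF ip_lim[OF rep_scale[OF r(1), of c] r(2)]]
      tendsto_mult_left[OF ip_lim[OF r], of c] by (simp add: scale_left)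
next
  fix u v assume "u \<in> H" "v \<in> H"
  then obtain a b where r: "rep a u" "rep b v" by (auto simp: H_def)
  have "(\<lambda>n. cnj (s (b n) (a n))) \<longlonglongrightarrow> cnj (ip v u)" by (intro tendsto_cnj ip_lim r)
  then have "(\<lambda>n. s (a n) (b n)) \<longlonglongrightarrow> cnj (ip v u)" by (simp add: commute[symmetric])
  then show "ip u v = cnj (ip v u)" using LIMSEQ_unique[OF ip_lim[OF r]] by simp
next
  fix u assume "u \<in> H"
  then obtain a where r: "rep a u" by (auto simp: H_def)
  have l: "(\<lambda>n. s (a n) (a n)) \<longlonglongrightarrow> ip u u" by (rule ip_lim[OF r r])
  have re: "(\<lambda>n. (D (a n))\<^sup>2) \<longlonglongrightarrow> Re (ip u u)" using tendsto_Re[OF l] by (simp add: D_square)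
  have im: "(\<lambda>n. 0) \<longlonglongrightarrow> Im (ip u u)" using tendsto_Im[OF l] by (simp add: D_square)
  show "0 \<le> ip u u"
    using LIMSEQ_le_const[OF re, of 0] LIMSEQ_unique[OF im, of 0] by (simp add: less_eq_complex_def)
  assume "ip u u = 0"
  then have "(\<lambda>n. sqrt ((D (a n))\<^sup>2)) \<longlonglongrightarrow> sqrt 0" using re by (intro tendsto_real_sqrt) simp
  then have d: "(\<lambda>n. D (a n)) \<longlonglongrightarrow> 0" by (simp add: D_ge)
  show "u = 0"
  proof
    fix x
    have "(\<lambda>n. s (a n) x) \<longlonglongrightarrow> 0"
      by (rule tendsto_0_le[of "\<lambda>n. D (a n)" _ _ "D x"])
        (use cs d D_ge in \<open>auto simp: d\<close>)
    moreover have "(\<lambda>n. s (a n) x) \<longlonglongrightarrow> u x" using r by (simp add: rep_def)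
    ultimately show "u x = 0 x" using LIMSEQ_unique by fastforce
  qed
qed

lemma norm_lim: assumes "rep a u" shows "(\<lambda>n. D (a n)) \<longlonglongrightarrow> ip_norm ip u"
  unfolding ip_norm_def D_def by (intro tendsto_real_sqrt tendsto_Re ip_lim assms)

lemma rep_approx: assumes "rep a u" "e > 0"
  shows "\<exists>N. \<forall>n\<ge>N. ip_norm ip (s (a n) - u) < e"
proof -
  obtain N where N: "\<forall>m\<ge>N. \<forall>n\<ge>N. D (a m - a n) < e / 2"
    using assms unfolding rep_def cau_def by (meson half_gt_zero)
  have "ip_norm ip (s (a n) - u) < e" if "n \<ge> N" for n
  proof -
    have "(\<lambda>k. D (a n - a k)) \<longlonglongrightarrow> ip_norm ip (s (a n) - u)"
      using norm_lim[OF rep_diff[OF rep_const assms(1)]] .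
    then have "ip_norm ip (s (a n) - u) \<le> e / 2"
      by (rule LIMSEQ_le_const2) (use N that less_imp_le in blast)
    then show ?thesis using assms(2) by simp
  qed
  then show ?thesis by blast
qed

lemma norm_s: "ip_norm ip (s a - s b) = D (a - b)"
proof -
  have "s a - s b = s (a - b)" by (simp add: fun_eq_iff diff_left)
  then show ?thesis by (simp add: ip_norm_def D_def ip_const)
qed

lemma norm_tri: assumes "u \<in> H" "v \<in> H" "w \<in> H"
  shows "ip_norm ip (u - w) \<le> ip_norm ip (u - v) + ip_norm ip (v - w)"
proof -
  obtain a b c where r: "rep a u" "rep b v" "rep c w" using assms by (auto simp: H_def)
  show ?thesis
    by (rule LIMSEQ_le[OF norm_lim[OF rep_diff[OF r(1,3)]]
        tendsto_add[OF norm_lim[OF rep_diff[OF r(1,2)]] norm_lim[OF rep_diff[OF r(2,3)]]]])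
      (use D_tri in blast)
qed

lemma norm_commute: assumes "u \<in> H" "v \<in> H" shows "ip_norm ip (u - v) = ip_norm ip (v - u)"
proof -
  obtain a b where r: "rep a u" "rep b v" using assms by (auto simp: H_def)
  show ?thesis
    using LIMSEQ_unique[OF norm_lim[OF rep_diff[OF r]]] norm_lim[OF rep_diff[OF r(2,1)]]
    by (simp add: D_minus[of "b _"])
qed

lemma s_in_H: "s a \<in> H"
  using rep_const by (auto simp: H_def)

lemma chilbert_H: "chilbert_space H ip"
proof -
  interpret cinner_space H ip by (rule cinner_H)
  show ?thesis
  proof
    fix u :: "nat \<Rightarrow> 'a \<Rightarrow> complex"
    assume uH: "\<And>n. u n \<in> H"
      and C: "\<And>e. e > 0 \<Longrightarrow> \<exists>N. \<forall>m\<ge>N. \<forall>n\<ge>N. ip_norm ip (u m - u n) < e"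
    have "\<exists>b. ip_norm ip (s b - u n) < 1 / Suc n" for n
      using uH[of n] rep_approx[of _ "u n" "1 / Suc n"] by (auto simp: H_def)
    then obtain b where b: "\<And>n. ip_norm ip (s (b n) - u n) < 1 / Suc n" by metis
    have eb: "\<exists>N. \<forall>n\<ge>N. ip_norm ip (s (b n) - u n) < e" if e: "e > 0" for e :: real
    proof -
      obtain N where N: "1 / Suc N < e" using e nat_approx_posE by blast
      have "ip_norm ip (s (b n) - u n) < e" if "n \<ge> N" for n
      proof -
        have "1 / Suc n \<le> 1 / Suc N" using that by (simp add: frac_le)
        then show ?thesis using b[of n] N by linarith
      qed
      then show ?thesis by blast
    qed
    have "cau b"
      unfolding cau_def
    proof (intro allI impI)
      fix e :: real assume "e > 0"
      then have e: "e / 3 > 0" by simp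
      obtain N1 where N1: "\<forall>m\<ge>N1. \<forall>n\<ge>N1. ip_norm ip (u m - u n) < e / 3" using C[OF e] by blast
      obtain N2 where N2: "\<forall>n\<ge>N2. ip_norm ip (s (b n) - u n) < e / 3" using eb[OF e] by blast
      have "D (b m - b n) < e" if "m \<ge> max N1 N2" "n \<ge> max N1 N2" for m n
      proof -
        have "ip_norm ip (s (b m) - s (b n)) \<le> ip_norm ip (s (b m) - u m) + ip_norm ip (u m - s (b n))"
          by (intro norm_tri s_in_H uH)
        also have "ip_norm ip (u m - s (b n)) \<le> ip_norm ip (u m - u n) + ip_norm ip (u n - s (b n))"
          by (intro norm_tri s_in_H uH)
        also have "ip_norm ip (u n - s (b n)) = ip_norm ip (s (b n) - u n)"
          by (intro norm_commute s_in_H uH)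
        finally have "D (b m - b n) \<le> ip_norm ip (s (b m) - u m) + (ip_norm ip (u m - u n) + ip_norm ip (s (b n) - u n))"
          by (simp only: norm_s)
        moreover have "ip_norm ip (s (b m) - u m) < e / 3" "ip_norm ip (u m - u n) < e / 3"
          "ip_norm ip (s (b n) - u n) < e / 3" using N1 N2 that by simp_all
        ultimately show ?thesis by simp
      qed
      then show "\<exists>N. \<forall>m\<ge>N. \<forall>n\<ge>N. D (b m - b n) < e" by blast
    qed
    then obtain v where v: "rep b v" by (rule rep_ex)
    then have vH: "v \<in> H" by (auto simp: H_def)
    have nn: "0 \<le> ip_norm ip (u n - v)" for n
      using norm_lim[OF v] unfolding ip_norm_def
      using ip_ge_zero[of "u n - v"] uH vH cvec.subspace_diff[OF subspace]
      by (simp add: less_eq_complex_def)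
    have "(\<lambda>n. ip_norm ip (u n - v)) \<longlonglongrightarrow> 0"
    proof (rule LIMSEQ_I)
      fix e :: real assume "0 < e"
      then have e: "e / 2 > 0" by simp
      obtain N1 where N1: "\<forall>n\<ge>N1. ip_norm ip (s (b n) - v) < e / 2" using rep_approx[OF v e] by blast
      obtain N2 where N2: "\<forall>n\<ge>N2. ip_norm ip (s (b n) - u n) < e / 2" using eb[OF e] by blast
      have "norm (ip_norm ip (u n - v) - 0) < e" if "n \<ge> max N1 N2" for n
      proof -
        have "ip_norm ip (u n - v) \<le> ip_norm ip (u n - s (b n)) + ip_norm ip (s (b n) - v)"
          by (intro norm_tri s_in_H uH vH)
        also have "ip_norm ip (u n - s (b n)) = ip_norm ip (s (b n) - u n)"
          by (intro norm_commute s_in_H uH)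
        finally have "ip_norm ip (u n - v) \<le> ip_norm ip (s (b n) - u n) + ip_norm ip (s (b n) - v)" .
        moreover have "ip_norm ip (s (b n) - u n) < e / 2" "ip_norm ip (s (b n) - v) < e / 2"
          using N1 N2 that by simp_all
        ultimately show ?thesis using nn[of n] by simp
      qed
      then show "\<exists>no. \<forall>n\<ge>no. norm (ip_norm ip (u n - v) - 0) < e" by blast
    qed
    with vH show "\<exists>v\<in>H. (\<lambda>n. ip_norm ip (u n - v)) \<longlonglongrightarrow> 0" by blast
  qed
qed

end

lemma positive_functional_psd_form:
  assumes "positive_functional g" shows "psd_form (\<lambda>a b. g (b\<^sup>\<star> * a))"
proof -
  have lin: "Vector_Spaces.linear (*\<^sub>C) (*\<^sub>C) g" and pos: "\<And>a. 0 \<le> g (a\<^sup>\<star> * a)"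
    using assms by (auto simp: positive_functional_def)
  interpret g: Vector_Spaces.linear "(*\<^sub>C)" "(*\<^sub>C)" g by (rule lin)
  have sc: "g (c *\<^sub>C a) = c * g a" for c a by (simp add: g.scale scaleC_complex_def)
  have ex: "g ((a + c *\<^sub>C b)\<^sup>\<star> * (a + c *\<^sub>C b))
      = g (a\<^sup>\<star> * a) + c * g (a\<^sup>\<star> * b) + cnj c * g (b\<^sup>\<star> * a) + cnj c * c * g (b\<^sup>\<star> * b)" for a b c
    by (simp add: star_add star_scaleC distrib_left distrib_right g.add mult_scaleC_left
        mult_scaleC_right sc)
  have imp: "Im (g (a\<^sup>\<star> * a)) = 0" for a using pos[of a] by (simp add: less_eq_complex_def)
  have comm: "g (b\<^sup>\<star> * a) = cnj (g (a\<^sup>\<star> * b))" for a b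
  proof -
    have "Im (c * g (a\<^sup>\<star> * b) + cnj c * g (b\<^sup>\<star> * a)) = 0" for c
      using imp[of "a + c *\<^sub>C b"] unfolding ex by (simp add: imp)
    from this[of 1] this[of \<i>] show ?thesis by (simp add: complex_eq_iff)
  qed
  show ?thesis
  proof
    show "g (b\<^sup>\<star> * a) = cnj (g (a\<^sup>\<star> * b))" for a b by (rule comm)
  qed (simp_all add: distrib_left g.add mult_scaleC_right sc pos)
qed

lemma gns_inner_gns_op:
  assumes "positive_functional g"
  shows "gns_inner g (gns_op g a) (gns_op g b) = g (b\<^sup>\<star> * a)"
proof -
  interpret psd_form "\<lambda>a b. g (b\<^sup>\<star> * a)" by (rule positive_functional_psd_form[OF assms])
  have "g (b'\<^sup>\<star> * a') = g (b\<^sup>\<star> * a)" if "gns_op g a = gns_op g a'" "gns_op g b = gns_op g b'" for a' b'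
  proof -
    have "g (b'\<^sup>\<star> * a') = g (b'\<^sup>\<star> * a)" using that(1) by (metis gns_op_def)
    also have "\<dots> = cnj (g (a\<^sup>\<star> * b'))" by (rule commute)
    also have "\<dots> = cnj (g (a\<^sup>\<star> * b))" using that(2) by (metis gns_op_def)
    finally show ?thesis using commute by metis
  qed
  then show ?thesis unfolding gns_inner_def by (intro the_equality) blast+
qed

lemma gns_completion_exists:
  assumes "positive_functional g"
  shows "\<exists>(H :: ('a::star_algebra \<Rightarrow> complex) set) ip. gns_completion g H ip id"
proof -
  interpret psd_form "\<lambda>a b. g (b\<^sup>\<star> * a)" by (rule positive_functional_psd_form[OF assms])
  interpret H: chilbert_space H ip by (rule chilbert_H)
  have op: "gns_op g = (\<lambda>a x. g (x\<^sup>\<star> * a))" by (simp add: fun_eq_iff gns_op_def)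
  have sub: "range (gns_op g) \<subseteq> H" using s_in_H by (auto simp: op)
  have ipr: "ip u v = gns_inner g u v" if "u \<in> range (gns_op g)" "v \<in> range (gns_op g)" for u v
    using that gns_inner_gns_op[OF assms] ip_const by (auto simp: op)
  have ss: "cvec.subspace (range (gns_op g))"
    unfolding cvec.subspace_def
  proof (intro conjI ballI allI)
    have "gns_op g 0 = 0" using zero_left by (simp add: fun_eq_iff gns_op_def)
    then show "0 \<in> range (gns_op g)" by (metis rangeI)
    fix u v assume "u \<in> range (gns_op g)" "v \<in> range (gns_op g)"
    then obtain a b where "u = gns_op g a" "v = gns_op g b" by blast
    then have "u + v = gns_op g (a + b)" by (simp add: fun_eq_iff op add_left)
    then show "u + v \<in> range (gns_op g)" by blast
  next
    fix c u assume "u \<in> range (gns_op g)"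
    then obtain a where "u = gns_op g a" by blast
    then have "c *\<^sub>C u = gns_op g (c *\<^sub>C a)"
      by (simp add: fun_eq_iff op scale_left scaleC_fun_def scaleC_complex_def)
    then show "c *\<^sub>C u \<in> range (gns_op g)" by blast
  qed
  have "cinner_space (range (gns_op g)) (gns_inner g)"
  proof
    fix u v w assume uvw: "u \<in> range (gns_op g)" "v \<in> range (gns_op g)" "w \<in> range (gns_op g)"
    have "u + v \<in> range (gns_op g)" using ss uvw(1,2) by (rule cvec.subspace_add)
    moreover have "u \<in> H" "v \<in> H" "w \<in> H" using uvw sub by auto
    ultimately show "gns_inner g (u + v) w = gns_inner g u w + gns_inner g v w"
      using H.ip_add_left[of u v w] uvw by (simp only: ipr)
  next
    fix u w c assume uw: "u \<in> range (gns_op g)" "w \<in> range (gns_op g)"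
    have "c *\<^sub>C u \<in> range (gns_op g)" using ss uw(1) by (rule cvec.subspace_scale)
    moreover have "u \<in> H" "w \<in> H" using uw sub by auto
    ultimately show "gns_inner g (c *\<^sub>C u) w = c * gns_inner g u w"
      using H.ip_scaleC_left[of u w c] uw by (simp only: ipr)
  next
    fix u v assume uv: "u \<in> range (gns_op g)" "v \<in> range (gns_op g)"
    moreover have "u \<in> H" "v \<in> H" using uv sub by auto
    ultimately show "gns_inner g u v = cnj (gns_inner g v u)"
      using H.ip_commute[of u v] by (simp only: ipr)
  next
    fix u assume u: "u \<in> range (gns_op g)"
    moreover have uH: "u \<in> H" using u sub by auto
    ultimately show "0 \<le> gns_inner g u u"
      using H.ip_ge_zero[of u] by (simp only: ipr)
    assume "gns_inner g u u = 0"
    with u uH show "u = 0" using H.ip_eq_zero[of u] by (simp only: ipr)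
  qed (fact ss)
  moreover have "\<exists>v\<in>range (gns_op g). ip_norm ip (v - h) < e" if "h \<in> H" "e > 0" for h e
  proof -
    obtain a where "rep a h" using \<open>h \<in> H\<close> by (auto simp: H_def)
    from rep_approx[OF this \<open>e > 0\<close>] show ?thesis by (auto simp: op)
  qed
  moreover have "id \<in> range (gns_op g) \<rightarrow> H" using sub by auto
  ultimately have "gns_completion g H ip id"
    unfolding hilbert_completion_def using chilbert_H ipr by (simp only: id_apply) simp
  then show ?thesis by blast
qed

end

theory Submission
  imports Defs
begin

text \<open>
  In the GNS space of \<open>g\<close>, write \<open>j a\<close> for the image of \<open>a\<close>, so that the norm of \<open>j a\<close> is
  \<open>sqrt (g (a\<^sup>\<star> a))\<close>. The subspace \<open>\<MM>\<close> consists of the limits of \<open>j (a\<^sub>n)\<close> along sequences that are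
  null for \<open>f\<close>: it measures how far the map from the seminorm of \<open>f\<close> to the norm of \<open>g\<close> is from
  being closable. It is a closed subspace, and it is invariant under all \<open>\<pi> x\<close>, since left
  multiplication is bounded for the seminorm of \<open>f\<close>. As \<open>\<pi>\<close> is a *-representation, \<open>P\<close> commutes with it.
  With \<open>\<pi> a \<zeta> = j a\<close> this gives \<open>g = g\<^sub>a + g\<^sub>s\<close>; moreover \<open>g\<^sub>s (a\<^sup>\<star> a)\<close> and \<open>g\<^sub>a (a\<^sup>\<star> a)\<close> are the squared
  norms of \<open>P (j a)\<close> and \<open>j a - P (j a)\<close>.

  The three remaining properties follow from one observation: for each \<open>a\<close> there is a sequence
  \<open>b\<^sub>n\<close>, null for \<open>f\<close>, with \<open>j (b\<^sub>n)\<close> converging to \<open>P (j a)\<close>.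

  Absolute continuity (\<open>ac_part_abs_continuous\<close>): if \<open>a\<^sub>n\<close> is null for \<open>f\<close> and fundamental for \<open>g\<^sub>a\<close>,
  the limit of \<open>j (a\<^sub>n) - P (j (a\<^sub>n))\<close> is orthogonal to \<open>\<MM>\<close>. Correcting the \<open>a\<^sub>n\<close> by elements that
  approximate \<open>P (j (a\<^sub>n))\<close> shows that it also belongs to \<open>\<MM>\<close>, so it is 0.

  Singularity (\<open>sing_part_singular\<close>): if \<open>h\<close> lies below \<open>f\<close> and \<open>g\<^sub>s\<close>, then \<open>b\<^sub>n\<close> is null for \<open>h\<close>, and so is
  \<open>a - b\<^sub>n\<close> because \<open>P (j (a - b\<^sub>n))\<close> tends to 0. Hence \<open>h (a\<^sup>\<star> a) = 0\<close>, and \<open>h = 0\<close> by representability.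

  Maximality (\<open>ac_part_maximal\<close>): if \<open>h \<preceq> g\<close> and \<open>h \<lless> f\<close>, then \<open>b\<^sub>n\<close> is null for \<open>h\<close>, and the
  \<open>h\<close>-seminorm of \<open>a - b\<^sub>n\<close> is at most the norm of \<open>j a - j (b\<^sub>n)\<close>, which tends to that of
  \<open>j a - P (j a)\<close>.

  The Hilbert space theory that this rests on is the projection theorem, the extension of bounded
  maps from a dense range (for \<open>\<pi>\<close>), and the Riesz representation (for \<open>\<zeta>\<close>).
\<close>

section \<open>Geometry of inner product spaces on a carrier\<close>

context cinner_space
begin

abbreviation nrm :: "'h \<Rightarrow> real" where "nrm \<equiv> ip_norm ip"

definition converges :: "(nat \<Rightarrow> 'h) \<Rightarrow> 'h \<Rightarrow> bool" (infix "\<leadsto>" 50) where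
  "u \<leadsto> v \<longleftrightarrow> (\<lambda>n. nrm (u n - v)) \<longlonglongrightarrow> 0"

definition fundamental :: "(nat \<Rightarrow> 'h) \<Rightarrow> bool" where
  "fundamental u \<longleftrightarrow> (\<forall>e>0. \<exists>N. \<forall>m\<ge>N. \<forall>n\<ge>N. nrm (u m - u n) < e)"

definition closed_subspace :: "'h set \<Rightarrow> bool" where
  "closed_subspace M \<longleftrightarrow> cvec.subspace M \<and> M \<subseteq> H \<and>
     (\<forall>u v. (\<forall>n. u n \<in> M) \<longrightarrow> v \<in> H \<longrightarrow> u \<leadsto> v \<longrightarrow> v \<in> M)"

lemma mem_zero [simp, intro]: "0 \<in> H"
  and mem_add [simp, intro]: "u \<in> H \<Longrightarrow> v \<in> H \<Longrightarrow> u + v \<in> H"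
  and mem_diff [simp, intro]: "u \<in> H \<Longrightarrow> v \<in> H \<Longrightarrow> u - v \<in> H"
  and mem_scale [simp, intro]: "u \<in> H \<Longrightarrow> c *\<^sub>C u \<in> H"
  by (auto intro: cvec.subspace_0 cvec.subspace_add cvec.subspace_diff cvec.subspace_scale subspace)

text \<open>
  A linear projection of the ambient space onto \<open>H\<close> extends the inner product to a positive
  semidefinite form on the whole type. Facts about such forms, in particular the Cauchy-Schwarz and
  triangle inequalities, thus transfer to \<open>H\<close>.
\<close>

lemma total_extension: "\<exists>s. psd_form s \<and> (\<forall>u\<in>H. \<forall>v\<in>H. s u v = ip u v)"
proof -
  interpret vector_space_pair "scaleC :: complex \<Rightarrow> 'h \<Rightarrow> 'h" "scaleC :: complex \<Rightarrow> 'h \<Rightarrow> 'h" ..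
  obtain q where q: "range q \<subseteq> H" "Vector_Spaces.linear (*\<^sub>C) (*\<^sub>C) q" "\<And>v. v \<in> H \<Longrightarrow> q v = v"
    using linear_exists_left_inverse_on[OF cvec.linear_id subspace] by auto
  interpret q: Vector_Spaces.linear "(*\<^sub>C)" "(*\<^sub>C)" q by (rule q(2))
  have H: "q u \<in> H" for u using q(1) by auto
  have "psd_form (\<lambda>u v. ip (q u) (q v))"
    by unfold_locales (use H in \<open>auto simp: q.add q.scale ip_add_left ip_scaleC_left ip_ge_zero
      intro: ip_commute\<close>)
  with q(3) show ?thesis by (intro exI[of _ "\<lambda>u v. ip (q u) (q v)"]) auto
qed

definition tot :: "'h \<Rightarrow> 'h \<Rightarrow> complex" where
  "tot = (SOME s. psd_form s \<and> (\<forall>u\<in>H. \<forall>v\<in>H. s u v = ip u v))"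

lemma psd_form_tot: "psd_form tot"
  and tot_eq: "u \<in> H \<Longrightarrow> v \<in> H \<Longrightarrow> tot u v = ip u v"
  using someI_ex[OF total_extension] unfolding tot_def by blast+

interpretation tot: psd_form tot by (rule psd_form_tot)

lemma D_tot: "u \<in> H \<Longrightarrow> tot.D u = nrm u"
  by (simp add: tot.D_def ip_norm_def tot_eq)

lemma ip_add_right: "\<lbrakk>u \<in> H; v \<in> H; w \<in> H\<rbrakk> \<Longrightarrow> ip u (v + w) = ip u v + ip u w"
  using tot.add_right[of u v w] by (simp add: tot_eq)

lemma ip_scale_right: "\<lbrakk>u \<in> H; v \<in> H\<rbrakk> \<Longrightarrow> ip u (c *\<^sub>C v) = cnj c * ip u v"
  using tot.scale_right[of u c v] by (simp add: tot_eq)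

lemma ip_diff_left: "\<lbrakk>u \<in> H; v \<in> H; w \<in> H\<rbrakk> \<Longrightarrow> ip (u - v) w = ip u w - ip v w"
  using tot.diff_left[of u v w] by (simp add: tot_eq)

lemma ip_diff_right: "\<lbrakk>u \<in> H; v \<in> H; w \<in> H\<rbrakk> \<Longrightarrow> ip u (v - w) = ip u v - ip u w"
  using tot.diff_right[of u v w] by (simp add: tot_eq)

lemma ip_zero_left: "v \<in> H \<Longrightarrow> ip 0 v = 0"
  using ip_diff_left[of 0 0 v] by simp

lemma nrm_ge_zero: "u \<in> H \<Longrightarrow> 0 \<le> nrm u"
  using tot.D_ge[of u] by (simp add: D_tot)

lemma ip_self: "u \<in> H \<Longrightarrow> ip u u = of_real ((nrm u)\<^sup>2)"
  using tot.D_square[of u] by (simp add: D_tot tot_eq)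

lemma nrm_eq_zero: "u \<in> H \<Longrightarrow> nrm u = 0 \<Longrightarrow> u = 0"
  by (rule ip_eq_zero) (simp_all add: ip_self)

lemma cauchy_schwarz: "\<lbrakk>u \<in> H; v \<in> H\<rbrakk> \<Longrightarrow> cmod (ip u v) \<le> nrm u * nrm v"
  using tot.cs[of u v] by (simp add: D_tot tot_eq)

lemma nrm_minus: "\<lbrakk>u \<in> H; v \<in> H\<rbrakk> \<Longrightarrow> nrm (u - v) = nrm (v - u)"
  using tot.D_minus[of u v] by (simp add: D_tot)

lemma nrm_add: "\<lbrakk>u \<in> H; v \<in> H\<rbrakk> \<Longrightarrow> nrm (u + v) \<le> nrm u + nrm v"
  using tot.D_add[of u v] by (simp add: D_tot)

lemma nrm_tri: "\<lbrakk>u \<in> H; v \<in> H; w \<in> H\<rbrakk> \<Longrightarrow> nrm (u - w) \<le> nrm (u - v) + nrm (v - w)"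
  using tot.D_tri[of u w v] by (simp add: D_tot)

lemma nrm_scale: "u \<in> H \<Longrightarrow> nrm (c *\<^sub>C u) = cmod c * nrm u"
  using tot.D_scale[of c u] by (simp add: D_tot)

lemma pythagoras:
  assumes "u \<in> H" "v \<in> H" "ip u v = 0"
  shows "(nrm (u + v))\<^sup>2 = (nrm u)\<^sup>2 + (nrm v)\<^sup>2"
proof -
  have "ip v u = 0" using ip_commute[OF assms(2,1)] assms(3) by simp
  then have "complex_of_real ((nrm (u + v))\<^sup>2) = of_real ((nrm u)\<^sup>2 + (nrm v)\<^sup>2)"
    using assms ip_self[of "u + v"] ip_self[of u] ip_self[of v]
    by (simp add: ip_add_left ip_add_right)
  then show ?thesis by (simp only: of_real_eq_iff)
qed

lemma parallelogram:
  assumes "u \<in> H" "v \<in> H"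
  shows "(nrm (u + v))\<^sup>2 + (nrm (u - v))\<^sup>2 = 2 * (nrm u)\<^sup>2 + 2 * (nrm v)\<^sup>2"
proof -
  have "ip (u + v) (u + v) + ip (u - v) (u - v) = 2 * ip u u + 2 * ip v v"
    using assms by (simp add: ip_add_left ip_add_right ip_diff_left ip_diff_right)
  then have "complex_of_real ((nrm (u + v))\<^sup>2 + (nrm (u - v))\<^sup>2)
      = of_real (2 * (nrm u)\<^sup>2 + 2 * (nrm v)\<^sup>2)"
    using assms by (simp add: ip_self)
  then show ?thesis by (simp only: of_real_eq_iff)
qed

lemma convergesI:
  assumes "\<And>n. u n \<in> H" "v \<in> H" "\<And>n. nrm (u n - v) \<le> x n" "x \<longlonglongrightarrow> 0"
  shows "u \<leadsto> v"
  unfolding converges_def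
  by (rule tendsto_sandwich[OF _ _ tendsto_const assms(4)]) (use assms nrm_ge_zero in auto)

lemma converges_const: "v \<in> H \<Longrightarrow> (\<lambda>n. v) \<leadsto> v"
  using nrm_scale[of 0 0] by (simp add: converges_def)

lemma converges_diff:
  assumes "\<And>n. u n \<in> H" "v \<in> H" "\<And>n. u' n \<in> H" "v' \<in> H" "u \<leadsto> v" "u' \<leadsto> v'"
  shows "(\<lambda>n. u n - u' n) \<leadsto> v - v'"
proof (rule convergesI)
  show "(\<lambda>n. nrm (u n - v) + nrm (u' n - v')) \<longlonglongrightarrow> 0"
    using assms(5,6) unfolding converges_def by (intro tendsto_add_zero)
  show "nrm (u n - u' n - (v - v')) \<le> nrm (u n - v) + nrm (u' n - v')" for n
    using nrm_add[of "u n - v" "v' - u' n"] nrm_minus[of v' "u' n"] assms(1-4)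
    by (simp add: algebra_simps)
qed (use assms in auto)

lemma converges_add:
  assumes "\<And>n. u n \<in> H" "v \<in> H" "\<And>n. u' n \<in> H" "v' \<in> H" "u \<leadsto> v" "u' \<leadsto> v'"
  shows "(\<lambda>n. u n + u' n) \<leadsto> v + v'"
proof (rule convergesI)
  show "(\<lambda>n. nrm (u n - v) + nrm (u' n - v')) \<longlonglongrightarrow> 0"
    using assms(5,6) unfolding converges_def by (intro tendsto_add_zero)
  show "nrm (u n + u' n - (v + v')) \<le> nrm (u n - v) + nrm (u' n - v')" for n
    using nrm_add[of "u n - v" "u' n - v'"] assms(1-4) by (simp add: algebra_simps)
qed (use assms in auto)

lemma converges_scale:
  assumes "\<And>n. u n \<in> H" "v \<in> H" "u \<leadsto> v"
  shows "(\<lambda>n. c *\<^sub>C u n) \<leadsto> c *\<^sub>C v"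
proof (rule convergesI)
  show "(\<lambda>n. cmod c * nrm (u n - v)) \<longlonglongrightarrow> 0"
    using assms(3) unfolding converges_def by (intro tendsto_mult_right_zero)
  show "nrm (c *\<^sub>C u n - c *\<^sub>C v) \<le> cmod c * nrm (u n - v)" for n
    using assms by (simp add: nrm_scale flip: cvec.scale_right_diff_distrib)
qed (use assms in auto)

lemma converges_ip:
  assumes "\<And>n. u n \<in> H" "v \<in> H" "w \<in> H" "u \<leadsto> v"
  shows "(\<lambda>n. ip (u n) w) \<longlonglongrightarrow> ip v w"
proof -
  have "cmod (ip (u n) w - ip v w) \<le> \<bar>nrm (u n - v)\<bar> * nrm w" for n
    using cauchy_schwarz[of "u n - v" w] nrm_ge_zero[of "u n - v"] assms(1-3)
    by (simp add: ip_diff_left)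
  then have "(\<lambda>n. ip (u n) w - ip v w) \<longlonglongrightarrow> 0"
    using assms(4) unfolding converges_def
    by (elim tendsto_0_le[where K = "nrm w"]) simp
  then show ?thesis by (simp add: LIM_zero_iff)
qed

lemma converges_ip_right:
  assumes "\<And>n. u n \<in> H" "v \<in> H" "w \<in> H" "u \<leadsto> v"
  shows "(\<lambda>n. ip w (u n)) \<longlonglongrightarrow> ip w v"
  using tendsto_cnj[OF converges_ip[OF assms]] ip_commute[OF assms(3)] assms(1,2) by simp

lemma converges_nrm:
  assumes "\<And>n. u n \<in> H" "v \<in> H" "u \<leadsto> v"
  shows "(\<lambda>n. nrm (u n)) \<longlonglongrightarrow> nrm v"
proof -
  have "\<bar>nrm (u n) - nrm v\<bar> \<le> nrm (u n - v)" for n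
    using nrm_add[of "u n - v" v] nrm_add[of "v - u n" "u n"] nrm_minus[of v "u n"] assms(1,2)
    by (simp add: abs_le_iff)
  then have "(\<lambda>n. nrm (u n) - nrm v) \<longlonglongrightarrow> 0"
    using assms(3) unfolding converges_def
    by (elim tendsto_0_le[where K = 1]) (simp add: order_trans[OF _ abs_ge_self])
  then show ?thesis by (simp add: LIM_zero_iff)
qed

lemma converges_unique:
  assumes "\<And>n. u n \<in> H" "v \<in> H" "w \<in> H" "u \<leadsto> v" "u \<leadsto> w"
  shows "v = w"
proof -
  have "ip v (v - w) = ip w (v - w)"
    using converges_ip[OF assms(1,2) _ assms(4)] converges_ip[OF assms(1,3) _ assms(5)] assms(2,3)
    by (meson LIMSEQ_unique mem_diff)
  then have "v - w = 0" using assms by (intro ip_eq_zero) (auto simp: ip_diff_left)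
  then show ?thesis by simp
qed

lemma converges_fundamental:
  assumes "\<And>n. u n \<in> H" "v \<in> H" "u \<leadsto> v"
  shows "fundamental u"
  unfolding fundamental_def
proof (intro allI impI)
  fix e :: real assume "e > 0"
  then obtain N where N: "\<And>n. n \<ge> N \<Longrightarrow> \<bar>nrm (u n - v)\<bar> < e / 2"
    using assms(3) unfolding converges_def by (force dest: LIMSEQ_D[of _ _ "e / 2"])
  have "nrm (u m - u n) < e" if "m \<ge> N" "n \<ge> N" for m n
    using nrm_tri[of "u m" v "u n"] N[OF that(1)] N[OF that(2)] assms(1,2) nrm_minus[of v "u n"] by auto
  then show "\<exists>N. \<forall>m\<ge>N. \<forall>n\<ge>N. nrm (u m - u n) < e" by blast
qed

lemma bounded_operator_converges:
  assumes T: "bounded_operator H ip T" and u: "\<And>n. u n \<in> H" "v \<in> H" "u \<leadsto> v"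
  shows "(\<lambda>n. T (u n)) \<leadsto> T v"
proof -
  obtain K where TH: "\<And>u. u \<in> H \<Longrightarrow> T u \<in> H"
      and add: "\<And>u v. \<lbrakk>u \<in> H; v \<in> H\<rbrakk> \<Longrightarrow> T (u + v) = T u + T v"
      and K: "\<And>u. u \<in> H \<Longrightarrow> nrm (T u) \<le> K * nrm u"
    using T unfolding bounded_operator_def Pi_iff by metis
  show ?thesis
  proof (rule convergesI)
    show "(\<lambda>n. K * nrm (u n - v)) \<longlonglongrightarrow> 0"
      using u(3) unfolding converges_def by (intro tendsto_mult_right_zero)
    show "nrm (T (u n) - T v) \<le> K * nrm (u n - v)" for n
      using K[of "u n - v"] add[of "u n - v" v] u by (simp add: eq_diff_eq)
  qed (use u TH in auto)
qed

end

context chilbert_space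
begin

lemma fundamental_converges:
  assumes "\<And>n. u n \<in> H" "fundamental u"
  obtains v where "v \<in> H" "u \<leadsto> v"
  using complete[of u] assms unfolding fundamental_def converges_def by blast

text \<open>
  If \<open>x\<close> had a component along \<open>m\<close>, subtracting a small positive multiple \<open>t\<close> of \<open>\<langle>x, m\<rangle> m\<close> would
  shorten \<open>x\<close>: the gain is linear in \<open>t\<close> and the loss is quadratic.
\<close>

lemma orthogonal_if_nearest:
  assumes "x \<in> H" "m \<in> H" "\<And>c. nrm x \<le> nrm (x - c *\<^sub>C m)"
  shows "ip x m = 0"
proof (rule ccontr)
  define c where "c = ip x m"
  assume "ip x m \<noteq> 0"
  then have c: "(cmod c)\<^sup>2 > 0" by (simp add: c_def)
  define t where "t = 1 / ((nrm m)\<^sup>2 + 1)"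
  have p: "(nrm m)\<^sup>2 + 1 > 0" by (simp add: add_nonneg_pos)
  then have t: "t > 0" "t * (nrm m)\<^sup>2 < 1" by (simp_all add: t_def)
  let ?y = "x - (of_real t * c) *\<^sub>C m"
  have cc: "c * cnj c = of_real ((cmod c)\<^sup>2)" by (simp only: complex_norm_square)
  have mx: "ip m x = cnj c" using ip_commute[OF assms(2,1)] by (simp add: c_def)
  have "ip ?y ?y = ip x x - of_real (2 * t) * (c * cnj c) + of_real (t\<^sup>2) * (c * cnj c) * ip m m"
    using assms(1,2)
    by (simp add: ip_diff_left ip_diff_right ip_scaleC_left ip_scale_right mx
        algebra_simps power2_eq_square flip: c_def)
  then have "complex_of_real ((nrm ?y)\<^sup>2)
      = of_real ((nrm x)\<^sup>2 - 2 * t * (cmod c)\<^sup>2 + t\<^sup>2 * (cmod c)\<^sup>2 * (nrm m)\<^sup>2)"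
    unfolding cc using assms(1,2) by (simp add: ip_self)
  then have "(nrm ?y)\<^sup>2 = (nrm x)\<^sup>2 - 2 * t * (cmod c)\<^sup>2 + t\<^sup>2 * (cmod c)\<^sup>2 * (nrm m)\<^sup>2"
    by (simp only: of_real_eq_iff)
  moreover have "(nrm x)\<^sup>2 \<le> (nrm ?y)\<^sup>2"
    using assms nrm_ge_zero by (intro power_mono) auto
  ultimately have "2 * (t * (cmod c)\<^sup>2) \<le> (t * (nrm m)\<^sup>2) * (t * (cmod c)\<^sup>2)"
    by (simp add: power2_eq_square algebra_simps)
  moreover have "t * (cmod c)\<^sup>2 > 0" using c t by simp
  ultimately show False using t(2) by (simp add: mult_le_cancel_right)
qed

text \<open>
  The projection theorem: a sequence in \<open>M\<close> that minimises the distance to \<open>u\<close> is fundamental by the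
  parallelogram law, and its limit is a nearest point of \<open>M\<close>.
\<close>

lemma orth_decomposition_exists:
  assumes M: "closed_subspace M" and u: "u \<in> H"
  shows "\<exists>p\<in>M. \<forall>m\<in>M. ip (u - p) m = 0"
proof -
  have MH: "m \<in> H" if "m \<in> M" for m using M that by (auto simp: closed_subspace_def)
  have sub: "cvec.subspace M" using M by (simp add: closed_subspace_def)
  define S where "S = (\<lambda>m. (nrm (u - m))\<^sup>2) ` M"
  define d where "d = Inf S"
  have Sne: "S \<noteq> {}" using cvec.subspace_0[OF sub] by (auto simp: S_def)
  have Sbd: "bdd_below S" unfolding S_def by (rule bdd_belowI[of _ 0]) auto
  have d_le: "d \<le> (nrm (u - m))\<^sup>2" if "m \<in> M" for m
    unfolding d_def using that Sbd by (intro cInf_lower) (auto simp: S_def)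
  have "\<exists>m\<in>M. (nrm (u - m))\<^sup>2 < d + 1 / Suc n" for n
    using cInf_lessD[OF Sne, of "d + 1 / Suc n"] by (auto simp: d_def S_def)
  then obtain m where m: "\<And>n. m n \<in> M" "\<And>n. (nrm (u - m n))\<^sup>2 < d + 1 / Suc n" by metis
  have mH: "m n \<in> H" for n using m(1) MH by blast
  have close: "(nrm (m k - m n))\<^sup>2 \<le> 2 / Suc n + 2 / Suc k" for n k
  proof -
    \<comment> \<open>Apply the parallelogram law to the two error vectors: half of their sum is the error at the
      midpoint, which lies in \<open>M\<close> and so has square at least \<open>d\<close>.\<close>
    let ?h = "(1/2 :: complex) *\<^sub>C (m n + m k)"
    have "?h \<in> M" using m(1) sub by (intro cvec.subspace_scale cvec.subspace_add)
    then have "d \<le> (nrm (u - ?h))\<^sup>2" by (rule d_le)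
    moreover have "(2::complex) *\<^sub>C (u - ?h) = (u - m n) + (u - m k)"
    proof -
      have "(2::complex) *\<^sub>C u = u + u"
        using scaleC_add_left[of 1 1 u] by (simp add: scaleC_one)
      then show ?thesis
        by (simp add: cvec.scale_right_diff_distrib scaleC_scaleC scaleC_one algebra_simps)
    qed
    then have "nrm ((u - m n) + (u - m k)) = 2 * nrm (u - ?h)"
      using nrm_scale[of "u - ?h" 2] u mH by simp
    moreover have "(u - m n) - (u - m k) = m k - m n" by simp
    ultimately show ?thesis
      using parallelogram[of "u - m n" "u - m k"] m(2)[of n] m(2)[of k] u mH
      by (simp add: power_mult_distrib)
  qed
  have "fundamental m"
    unfolding fundamental_def
  proof (intro allI impI)
    fix e :: real assume e: "e > 0"
    then obtain N where N: "1 / Suc N < e\<^sup>2 / 4" using nat_approx_posE[of "e\<^sup>2/4"] by auto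
    have "nrm (m k - m n) < e" if "k \<ge> N" "n \<ge> N" for k n
    proof (rule power2_less_imp_less)
      have "1 / Suc n \<le> 1 / Suc N" "1 / Suc k \<le> 1 / Suc N" using that by (simp_all add: frac_le)
      then show "(nrm (m k - m n))\<^sup>2 < e\<^sup>2" using close[of k n] N by simp
    qed (use e in simp)
    then show "\<exists>N. \<forall>k\<ge>N. \<forall>n\<ge>N. nrm (m k - m n) < e" by blast
  qed
  then obtain p where p: "p \<in> H" "m \<leadsto> p" using fundamental_converges mH by blast
  have pM: "p \<in> M" using M p m(1) unfolding closed_subspace_def by blast
  have "(\<lambda>n. u - m n) \<leadsto> u - p"
    using u mH p by (intro converges_diff converges_const) auto
  then have "(\<lambda>n. (nrm (u - m n))\<^sup>2) \<longlonglongrightarrow> (nrm (u - p))\<^sup>2"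
    using u mH p(1) by (intro tendsto_power converges_nrm) auto
  moreover have "(\<lambda>n. d + 1 / real (Suc n)) \<longlonglongrightarrow> d + 0"
    by (intro tendsto_add tendsto_const LIMSEQ_inverse_real_of_nat[unfolded inverse_eq_divide])
  ultimately have min: "(nrm (u - p))\<^sup>2 \<le> d"
    using less_imp_le[OF m(2)] by (simp add: LIMSEQ_le[of "\<lambda>n. (nrm (u - m n))\<^sup>2"])
  have "ip (u - p) v = 0" if v: "v \<in> M" for v
  proof (rule orthogonal_if_nearest)
    fix c
    have "p + c *\<^sub>C v \<in> M" using pM v sub by (intro cvec.subspace_add cvec.subspace_scale)
    then have "(nrm (u - p))\<^sup>2 \<le> (nrm (u - p - c *\<^sub>C v))\<^sup>2"
      using order_trans[OF min d_le[of "p + c *\<^sub>C v"]] by (simp add: diff_diff_add)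
    then show "nrm (u - p) \<le> nrm (u - p - c *\<^sub>C v)"
      by (rule power2_le_imp_le) (use u p v MH nrm_ge_zero in auto)
  qed (use u p v MH in auto)
  with pM show ?thesis by blast
qed

lemma orth_projection_eqI:
  assumes M: "closed_subspace M" and u: "u \<in> H" and p: "p \<in> M" "\<And>m. m \<in> M \<Longrightarrow> ip (u - p) m = 0"
  shows "orth_projection M ip u = p"
  unfolding orth_projection_def
proof (rule the_equality)
  fix q assume q: "q \<in> M \<and> (\<forall>m\<in>M. ip (u - q) m = 0)"
  have MH: "m \<in> H" if "m \<in> M" for m using M that by (auto simp: closed_subspace_def)
  have qp: "q - p \<in> M" using M p q by (auto simp: closed_subspace_def intro: cvec.subspace_diff)
  have "ip (q - p) (q - p) = ip (u - p) (q - p) - ip (u - q) (q - p)"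
    using u p q MH by (subst ip_diff_left[symmetric]) auto
  also have "\<dots> = 0" using p(2)[OF qp] q qp by simp
  finally have "q - p = 0" using MH qp by (intro ip_eq_zero) auto
  then show "q = p" by simp
qed (use p in auto)

lemma
  assumes "closed_subspace M" "u \<in> H"
  shows orth_projection_mem: "orth_projection M ip u \<in> M"
    and orth_projection_orth: "m \<in> M \<Longrightarrow> ip (u - orth_projection M ip u) m = 0"
  using orth_decomposition_exists[OF assms] orth_projection_eqI[OF assms] by blast+

lemma orth_projection_of_mem:
  assumes "closed_subspace M" "u \<in> M"
  shows "orth_projection M ip u = u"
  using assms by (intro orth_projection_eqI) (auto simp: closed_subspace_def ip_zero_left)

lemma orth_projection_diff:
  assumes M: "closed_subspace M" and uv: "u \<in> H" "v \<in> H"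
  shows "orth_projection M ip (u - v) = orth_projection M ip u - orth_projection M ip v"
proof (rule orth_projection_eqI[OF M])
  let ?P = "orth_projection M ip"
  have MH: "m \<in> H" if "m \<in> M" for m using M that by (auto simp: closed_subspace_def)
  note mem = orth_projection_mem[OF M uv(1)] orth_projection_mem[OF M uv(2)]
  show "?P u - ?P v \<in> M"
    using M mem by (auto simp: closed_subspace_def intro: cvec.subspace_diff)
  show "ip (u - v - (?P u - ?P v)) m = 0" if m: "m \<in> M" for m
  proof -
    have "ip ((u - ?P u) - (v - ?P v)) m = 0"
      using orth_projection_orth[OF M uv(1) m] orth_projection_orth[OF M uv(2) m] uv mem MH m
      by (subst ip_diff_left) auto
    then show ?thesis by (simp add: algebra_simps)
  qed
qed (use uv in auto)

lemma nrm_orth_projection_le: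
  assumes M: "closed_subspace M" and u: "u \<in> H"
  shows "nrm (orth_projection M ip u) \<le> nrm u"
proof (rule power2_le_imp_le)
  let ?p = "orth_projection M ip u"
  have p: "?p \<in> M" "?p \<in> H"
    using orth_projection_mem[OF M u] M by (auto simp: closed_subspace_def)
  have "(nrm ((u - ?p) + ?p))\<^sup>2 = (nrm (u - ?p))\<^sup>2 + (nrm ?p)\<^sup>2"
    using orth_projection_orth[OF M u p(1)] u p(2) by (intro pythagoras) auto
  then show "(nrm ?p)\<^sup>2 \<le> (nrm u)\<^sup>2" by simp
qed (rule nrm_ge_zero[OF u])

end


section \<open>Closures of images under a dense linear map\<close>

definition seminorm :: "('a::complex_vector \<Rightarrow> real) \<Rightarrow> bool" where
  "seminorm p \<longleftrightarrow> (\<forall>a. 0 \<le> p a) \<and> (\<forall>a b. p (a + b) \<le> p a + p b) \<and>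
     (\<forall>c a. p (c *\<^sub>C a) = cmod c * p a)"

text \<open>
  The instance of interest is the canonical map of a *-algebra into the GNS space of a functional,
  for which the abstract results yield the cyclic vector, the representation and the singular
  subspace.
\<close>

locale dense_linear_map = chilbert_space H ip
  for H :: "'h::complex_vector set" and ip :: "'h \<Rightarrow> 'h \<Rightarrow> complex" +
  fixes j :: "'a::complex_vector \<Rightarrow> 'h"
  assumes map_mem [simp, intro]: "j a \<in> H"
    and map_add: "j (a + b) = j a + j b"
    and map_scale: "j (c *\<^sub>C a) = c *\<^sub>C j a"
    and dense: "u \<in> H \<Longrightarrow> e > 0 \<Longrightarrow> \<exists>a. nrm (j a - u) < e"
begin

lemma map_diff: "j (a - b) = j a - j b"
  using map_add[of "a - b" b] by (simp add: algebra_simps)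

lemma approximating_sequence:
  assumes "u \<in> H"
  obtains a where "(\<lambda>n. j (a n)) \<leadsto> u"
proof -
  have "\<exists>a. nrm (j a - u) < inverse (real (Suc n))" for n by (rule dense[OF assms]) simp
  then obtain a where a: "\<And>n. nrm (j (a n) - u) < inverse (real (Suc n))" by metis
  have "(\<lambda>n. j (a n)) \<leadsto> u"
    by (rule convergesI[OF _ assms less_imp_le[OF a] LIMSEQ_inverse_real_of_nat]) auto
  then show ?thesis by (rule that)
qed

lemma eq_if_ip_map_eq:
  assumes "u \<in> H" "v \<in> H" "\<And>a. ip u (j a) = ip v (j a)"
  shows "u = v"
proof -
  obtain a where a: "(\<lambda>n. j (a n)) \<leadsto> u - v" using approximating_sequence assms by blast
  have "(\<lambda>n. ip (u - v) (j (a n))) \<longlonglongrightarrow> ip (u - v) (u - v)"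
    using a assms by (intro converges_ip_right) auto
  then have "(\<lambda>n. 0 :: complex) \<longlonglongrightarrow> ip (u - v) (u - v)" using assms by (simp add: ip_diff_left)
  then have "ip (u - v) (u - v) = 0" by (rule LIMSEQ_unique[OF _ tendsto_const])
  then have "u - v = 0" using assms by (intro ip_eq_zero) auto
  then show ?thesis by simp
qed

text \<open>
  With the seminorm \<open>a \<mapsto> sqrt (f (a\<^sup>\<star> a))\<close> this is the singular subspace of the decomposition. With
  \<open>a \<mapsto> \<bar>g a\<bar>\<close> for a bounded functional \<open>g\<close> it is the closure of the image of the kernel of \<open>g\<close>, which
  gives the Riesz representation theorem.
\<close>

definition null_limits :: "('a \<Rightarrow> real) \<Rightarrow> 'h set" where
  "null_limits p = {z \<in> H. \<exists>a. (\<lambda>n. p (a n)) \<longlonglongrightarrow> 0 \<and> (\<lambda>n. j (a n)) \<leadsto> z}"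

lemma null_limitsI:
  assumes "z \<in> H" "\<And>a. 0 \<le> p a" "\<And>e. e > 0 \<Longrightarrow> \<exists>a. p a < e \<and> nrm (j a - z) < e"
  shows "z \<in> null_limits p"
proof -
  have "\<exists>a. p a < inverse (real (Suc n)) \<and> nrm (j a - z) < inverse (real (Suc n))" for n
    by (rule assms(3)) simp
  then obtain a where a: "\<And>n. p (a n) < inverse (real (Suc n))"
      "\<And>n. nrm (j (a n) - z) < inverse (real (Suc n))" by metis
  have "(\<lambda>n. j (a n)) \<leadsto> z"
    by (rule convergesI[OF _ assms(1) less_imp_le[OF a(2)] LIMSEQ_inverse_real_of_nat]) auto
  moreover have "(\<lambda>n. p (a n)) \<longlonglongrightarrow> 0"
    by (rule tendsto_sandwich[OF _ _ tendsto_const LIMSEQ_inverse_real_of_nat])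
      (use assms(2) less_imp_le[OF a(1)] in auto)
  ultimately show ?thesis using assms(1) by (auto simp: null_limits_def)
qed

lemma null_limitsD:
  assumes "z \<in> null_limits p" "e > 0"
  shows "\<exists>a. p a < e \<and> nrm (j a - z) < e"
proof -
  obtain a where a: "(\<lambda>n. p (a n)) \<longlonglongrightarrow> 0" "(\<lambda>n. nrm (j (a n) - z)) \<longlonglongrightarrow> 0"
    using assms(1) by (auto simp: null_limits_def converges_def)
  have "\<forall>\<^sub>F n in sequentially. p (a n) < e \<and> nrm (j (a n) - z) < e"
    using order_tendstoD(2)[OF a(1) assms(2)] order_tendstoD(2)[OF a(2) assms(2)]
    by (rule eventually_conj)
  then show ?thesis using eventually_happens' sequentially_bot by blast
qed

text \<open>
  Closedness comes from a diagonal choice, for which the approximation criterion of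
  \<open>null_limitsI\<close> replaces the bookkeeping with double sequences.
\<close>

lemma null_limits_closed_subspace:
  assumes "seminorm p"
  shows "closed_subspace (null_limits p)"
  unfolding closed_subspace_def cvec.subspace_def
proof (intro conjI ballI allI impI)
  have p: "0 \<le> p a" "p (a + b) \<le> p a + p b" "p (c *\<^sub>C a) = cmod c * p a" for a b c
    using assms by (auto simp: seminorm_def)
  have MH: "z \<in> H" if "z \<in> null_limits p" for z using that by (simp add: null_limits_def)
  then show "null_limits p \<subseteq> H" by blast
  show zero: "0 \<in> null_limits p"
  proof -
    have "p 0 = 0" using p(3)[of 0 0] by simp
    moreover have "j 0 = 0" using map_diff[of 0 0] by simp
    ultimately show ?thesis
      using nrm_scale[of 0 0] by (intro null_limitsI p(1)) (auto intro!: exI[of _ 0])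
  qed
  show "u + v \<in> null_limits p" if uv: "u \<in> null_limits p" "v \<in> null_limits p" for u v
  proof (rule null_limitsI)
    fix e :: real assume "e > 0"
    then have e: "e / 2 > 0" by simp
    obtain a b where ab: "p a < e / 2" "nrm (j a - u) < e / 2" "p b < e / 2" "nrm (j b - v) < e / 2"
      using null_limitsD[OF uv(1) e] null_limitsD[OF uv(2) e] by blast
    have "p (a + b) < e" using p(2)[of a b] ab by simp
    moreover have "nrm (j (a + b) - (u + v)) < e"
      using nrm_add[of "j a - u" "j b - v"] ab MH uv by (simp add: map_add algebra_simps)
    ultimately show "\<exists>a. p a < e \<and> nrm (j a - (u + v)) < e" by blast
  qed (use MH uv p in auto)
  show "c *\<^sub>C u \<in> null_limits p" if u: "u \<in> null_limits p" for c u
  proof -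
    obtain a where a: "(\<lambda>n. p (a n)) \<longlonglongrightarrow> 0" "(\<lambda>n. j (a n)) \<leadsto> u"
      using u by (auto simp: null_limits_def)
    have "(\<lambda>n. p (c *\<^sub>C a n)) \<longlonglongrightarrow> 0" unfolding p(3) by (intro tendsto_mult_right_zero a)
    moreover have "(\<lambda>n. j (c *\<^sub>C a n)) \<leadsto> c *\<^sub>C u"
      unfolding map_scale by (intro converges_scale a MH u map_mem)
    ultimately show ?thesis
      unfolding null_limits_def
      by (intro CollectI conjI exI[of _ "\<lambda>n. c *\<^sub>C a n"] mem_scale MH u)
  qed
  show "v \<in> null_limits p" if u: "\<forall>n. u n \<in> null_limits p" "v \<in> H" "u \<leadsto> v" for u v
  proof (rule null_limitsI)
    fix e :: real assume "e > 0"
    then have e: "e / 2 > 0" by simp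
    obtain n where n: "nrm (u n - v) < e / 2"
      using eventually_happens'[OF sequentially_bot order_tendstoD(2)[OF u(3)[unfolded converges_def] e]]
      by blast
    obtain a where a: "p a < e / 2" "nrm (j a - u n) < e / 2"
      using null_limitsD[OF spec[OF u(1)] e] by blast
    have "nrm (j a - v) < e" using nrm_tri[of "j a" "u n" v] a n MH u by fastforce
    then show "\<exists>a. p a < e \<and> nrm (j a - v) < e" using a p(1)[of a] e by (intro exI[of _ a]) simp
  qed (use u p in auto)
qed

text \<open>
  A bound of \<open>L a\<close> in terms of \<open>j a\<close> makes \<open>L\<close> send sequences whose images under \<open>j\<close> converge
  to fundamental ones, with a limit depending only on the limit under \<open>j\<close>. Restricting to
  \<open>extensional\<close> maps makes the extension unique as a function on the whole type.
\<close>

lemma bounded_extension: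
  fixes L :: "'a \<Rightarrow> 'h"
  assumes LH: "\<And>a. L a \<in> H" and add: "\<And>a b. L (a + b) = L a + L b"
    and scale: "\<And>c a. L (c *\<^sub>C a) = c *\<^sub>C L a"
    and bound: "\<And>a. nrm (L a) \<le> K * nrm (j a)" and K: "0 \<le> K"
  shows "\<exists>!T. T \<in> extensional H \<and> bounded_operator H ip T \<and> (\<forall>a. T (j a) = L a)"
proof (rule ex_ex1I)
  have diff: "L (a - b) = L a - L b" for a b using add[of "a - b" b] by (simp add: algebra_simps)
  have "\<exists>v. v \<in> H \<and> (\<exists>a. (\<lambda>n. j (a n)) \<leadsto> u \<and> (\<lambda>n. L (a n)) \<leadsto> v)" if u: "u \<in> H" for u
  proof -
    obtain a where a: "(\<lambda>n. j (a n)) \<leadsto> u" using approximating_sequence u by blast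
    have "fundamental (\<lambda>n. L (a n))"
      unfolding fundamental_def
    proof (intro allI impI)
      fix e :: real assume "e > 0"
      then have "e / (K + 1) > 0" using K by simp
      then obtain N where N: "\<And>m n. m \<ge> N \<Longrightarrow> n \<ge> N \<Longrightarrow> nrm (j (a m) - j (a n)) < e / (K + 1)"
        using converges_fundamental[OF _ u a] unfolding fundamental_def by blast
      have "nrm (L (a m) - L (a n)) < e" if "m \<ge> N" "n \<ge> N" for m n
      proof -
        have "nrm (L (a m) - L (a n)) \<le> K * nrm (j (a m) - j (a n))"
          using bound[of "a m - a n"] by (simp add: diff map_diff)
        also have "\<dots> \<le> (K + 1) * nrm (j (a m) - j (a n))"
          using nrm_ge_zero by (intro mult_right_mono) auto
        also have "\<dots> < e" using N[OF that] K by (simp add: field_simps)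
        finally show ?thesis .
      qed
      then show "\<exists>N. \<forall>m\<ge>N. \<forall>n\<ge>N. nrm (L (a m) - L (a n)) < e" by blast
    qed
    then show ?thesis using a fundamental_converges LH by metis
  qed
  then obtain T where TH: "\<And>u. u \<in> H \<Longrightarrow> T u \<in> H"
    and T: "\<And>u. u \<in> H \<Longrightarrow> \<exists>a. (\<lambda>n. j (a n)) \<leadsto> u \<and> (\<lambda>n. L (a n)) \<leadsto> T u" by metis
  have T_bound: "nrm v \<le> K * nrm u"
    if "u \<in> H" "v \<in> H" "(\<lambda>n. j (a n)) \<leadsto> u" "(\<lambda>n. L (a n)) \<leadsto> v" for a u v
  proof (rule LIMSEQ_le)
    show "(\<lambda>n. nrm (L (a n))) \<longlonglongrightarrow> nrm v" using that LH by (intro converges_nrm) auto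
    show "(\<lambda>n. K * nrm (j (a n))) \<longlonglongrightarrow> K * nrm u"
      using that by (intro tendsto_mult tendsto_const converges_nrm) auto
  qed (use bound in blast)
  have T_eq: "T u = v"
    if u: "u \<in> H" and v: "v \<in> H" and a: "(\<lambda>n. j (a n)) \<leadsto> u" "(\<lambda>n. L (a n)) \<leadsto> v" for a u v
  proof -
    obtain b where b: "(\<lambda>n. j (b n)) \<leadsto> u" "(\<lambda>n. L (b n)) \<leadsto> T u" using T u by blast
    have "(\<lambda>n. j (b n) - j (a n)) \<leadsto> u - u" by (intro converges_diff a b u map_mem)
    moreover have "(\<lambda>n. L (b n) - L (a n)) \<leadsto> T u - v" by (intro converges_diff a b u v TH LH)
    ultimately have "nrm (T u - v) \<le> K * nrm (0 :: 'h)"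
      using T_bound[of 0 "T u - v" "\<lambda>n. b n - a n"] u v TH by (simp add: diff map_diff)
    then have "nrm (T u - v) = 0"
      using nrm_scale[of 0 0] nrm_ge_zero[of "T u - v"] u v TH by simp
    then show ?thesis using nrm_eq_zero[of "T u - v"] u v TH by simp
  qed
  let ?T = "restrict T H"
  have "bounded_operator H ip ?T"
    unfolding bounded_operator_def
  proof (intro conjI ballI allI exI[of _ K])
    fix u v assume uv: "u \<in> H" "v \<in> H"
    obtain a b where ab: "(\<lambda>n. j (a n)) \<leadsto> u" "(\<lambda>n. L (a n)) \<leadsto> T u"
        "(\<lambda>n. j (b n)) \<leadsto> v" "(\<lambda>n. L (b n)) \<leadsto> T v"
      using T uv by metis
    have "(\<lambda>n. j (a n + b n)) \<leadsto> u + v" "(\<lambda>n. L (a n + b n)) \<leadsto> T u + T v"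
      unfolding add map_add by (intro converges_add ab uv TH LH map_mem)+
    then show "?T (u + v) = ?T u + ?T v" using T_eq uv TH by auto
  next
    fix c u assume u: "u \<in> H"
    obtain a where a: "(\<lambda>n. j (a n)) \<leadsto> u" "(\<lambda>n. L (a n)) \<leadsto> T u" using T u by blast
    have "(\<lambda>n. j (c *\<^sub>C a n)) \<leadsto> c *\<^sub>C u" "(\<lambda>n. L (c *\<^sub>C a n)) \<leadsto> c *\<^sub>C T u"
      unfolding scale map_scale by (intro converges_scale a u TH LH map_mem)+
    then show "?T (c *\<^sub>C u) = c *\<^sub>C ?T u" using T_eq u TH by auto
    show "nrm (?T u) \<le> K * nrm u" using T_bound a u TH by auto
  qed (use TH in auto)
  moreover have "?T (j a) = L a" for a
    using T_eq[of "j a" "L a" "\<lambda>n. a"] LH converges_const by auto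
  ultimately show "\<exists>T. T \<in> extensional H \<and> bounded_operator H ip T \<and> (\<forall>a. T (j a) = L a)"
    by (intro exI[of _ ?T]) auto
next
  fix S T :: "'h \<Rightarrow> 'h"
  assume S: "S \<in> extensional H \<and> bounded_operator H ip S \<and> (\<forall>a. S (j a) = L a)"
    and T: "T \<in> extensional H \<and> bounded_operator H ip T \<and> (\<forall>a. T (j a) = L a)"
  show "S = T"
  proof (rule extensionalityI)
    fix u assume u: "u \<in> H"
    obtain a where a: "(\<lambda>n. j (a n)) \<leadsto> u" using approximating_sequence u by blast
    have "(\<lambda>n. L (a n)) \<leadsto> R u"
      if "bounded_operator H ip R" "\<And>a. R (j a) = L a" for R
      using bounded_operator_converges[OF that(1) _ u a] that(2) by simp
    then show "S u = T u"
      using S T u LH by (intro converges_unique[of "\<lambda>n. L (a n)"]) (auto simp: bounded_operator_def)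
  qed (use S T in auto)
qed

text \<open>
  If \<open>g e = 1\<close>, the component \<open>w\<close> of \<open>j e\<close> orthogonal to the image of the kernel of \<open>g\<close> represents
  \<open>g\<close> up to a scalar, because \<open>a - g(a) e\<close> is always in the kernel.
\<close>

lemma riesz_on_dense_range:
  fixes g :: "'a \<Rightarrow> complex"
  assumes add: "\<And>a b. g (a + b) = g a + g b" and scale: "\<And>c a. g (c *\<^sub>C a) = c * g a"
    and bound: "\<And>a. cmod (g a) \<le> K * nrm (j a)"
  shows "\<exists>!z. z \<in> H \<and> (\<forall>a. g a = ip (j a) z)"
proof (rule ex_ex1I)
  have diff: "g (a - b) = g a - g b" for a b using add[of "a - b" b] by (simp add: algebra_simps)
  show "\<exists>z. z \<in> H \<and> (\<forall>a. g a = ip (j a) z)"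
  proof (cases "\<forall>a. g a = 0")
    case True
    moreover have "ip (j a) 0 = 0" for a using ip_diff_right[of "j a" 0 0] by simp
    ultimately show ?thesis by (intro exI[of _ 0]) auto
  next
    case False
    then obtain e0 where e0: "g e0 \<noteq> 0" by blast
    define e where "e = (1 / g e0) *\<^sub>C e0"
    have e: "g e = 1" using e0 by (simp add: e_def scale)
    define N where "N = null_limits (\<lambda>a. cmod (g a))"
    have N: "closed_subspace N"
      unfolding N_def by (rule null_limits_closed_subspace)
        (auto simp: seminorm_def add scale norm_mult norm_triangle_ineq)
    have ker: "j a \<in> N" if "g a = 0" for a
      using that converges_const[of "j a"]
      by (auto simp: N_def null_limits_def intro!: exI[of _ "\<lambda>n. a"])
    define p where "p = orth_projection N ip (j e)"
    define w where "w = j e - p"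
    have p: "p \<in> N" "\<And>m. m \<in> N \<Longrightarrow> ip w m = 0"
      using orth_projection_mem[OF N, of "j e"] orth_projection_orth[OF N, of "j e"]
      by (auto simp: p_def w_def)
    have pH: "p \<in> H" using p(1) by (simp add: N_def null_limits_def)
    then have wH: "w \<in> H" by (simp add: w_def)
    \<comment> \<open>Boundedness of \<open>g\<close> keeps \<open>j e\<close>, where \<open>g\<close> is 1, away from the closure of the kernel.\<close>
    have "j e \<notin> N"
    proof
      assume "j e \<in> N"
      then obtain a where a: "(\<lambda>n. cmod (g (a n))) \<longlonglongrightarrow> 0" "(\<lambda>n. nrm (j (a n) - j e)) \<longlonglongrightarrow> 0"
        by (auto simp: N_def null_limits_def converges_def)
      have "(\<lambda>n. cmod (g (a n)) + K * nrm (j (a n) - j e)) \<longlonglongrightarrow> 0 + K * 0"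
        by (intro tendsto_intros a)
      moreover have "1 \<le> cmod (g (a n)) + K * nrm (j (a n) - j e)" for n
      proof -
        have "1 = cmod (g (a n) - g (a n - e))" by (simp add: diff e)
        also have "\<dots> \<le> cmod (g (a n)) + cmod (g (a n - e))" by (rule norm_triangle_ineq4)
        finally show ?thesis using bound[of "a n - e"] by (simp add: map_diff)
      qed
      ultimately have "(1::real) \<le> 0 + K * 0" by (intro LIMSEQ_le_const) auto
      then show False by simp
    qed
    then have "w \<noteq> 0" using p(1) by (auto simp: w_def)
    then have ww: "ip w w \<noteq> 0" using ip_eq_zero wH by blast
    have "ip p w = 0" using ip_commute[OF pH wH] p by simp
    then have je: "ip (j e) w = ip w w" using pH wH by (simp add: w_def ip_diff_left)
    have "g a = ip (j a) ((1 / cnj (ip w w)) *\<^sub>C w)" for a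
    proof -
      have "ip w (j (a - g a *\<^sub>C e)) = 0" by (intro p(2) ker) (simp add: diff scale e)
      then have "ip (j (a - g a *\<^sub>C e)) w = 0"
        using ip_commute[of "j (a - g a *\<^sub>C e)" w] wH by simp
      then have "ip (j a) w = g a * ip w w"
        using wH by (simp add: map_diff map_scale ip_diff_left ip_scaleC_left je)
      then show ?thesis using wH ww by (simp add: ip_scale_right)
    qed
    then show ?thesis using wH by blast
  qed
  fix y z assume yz: "y \<in> H \<and> (\<forall>a. g a = ip (j a) y)" "z \<in> H \<and> (\<forall>a. g a = ip (j a) z)"
  show "y = z"
  proof (rule eq_if_ip_map_eq)
    show "ip y (j a) = ip z (j a)" for a
      using yz ip_commute[of y "j a"] ip_commute[of z "j a"] by auto
  qed (use yz in auto)
qed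

end


section \<open>Positive functionals as seminorms\<close>

text \<open>
  For a positive functional this is the seminorm of its GNS space. The order, absolute continuity
  and the boundedness conditions defining representability can all be expressed by it.
\<close>

definition fnorm :: "('a::star_algebra \<Rightarrow> complex) \<Rightarrow> 'a \<Rightarrow> real" where
  "fnorm f a = sqrt (Re (f (a\<^sup>\<star> * a)))"

lemma positive_functional_linear:
  assumes "positive_functional f"
  shows "f (a + b) = f a + f b" "f (c *\<^sub>C a) = c * f a"
proof -
  interpret f: Vector_Spaces.linear "(*\<^sub>C)" "(*\<^sub>C)" f
    using assms by (simp add: positive_functional_def)
  show "f (a + b) = f a + f b" "f (c *\<^sub>C a) = c * f a"
    by (simp_all add: f.add f.scale scaleC_complex_def)
qed

lemma positive_functionalI:
  assumes "\<And>a b. f (a + b) = f a + f b" "\<And>c a. f (c *\<^sub>C a) = c * f a" "\<And>a. 0 \<le> f (a\<^sup>\<star> * a)"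
  shows "positive_functional f"
  unfolding positive_functional_def
proof
  show "Vector_Spaces.linear (*\<^sub>C) (*\<^sub>C) f"
    by unfold_locales (simp_all add: assms scaleC_complex_def)
qed (use assms in auto)

lemma
  assumes "positive_functional f"
  shows fnorm_ge_zero: "0 \<le> fnorm f a"
    and fnorm_square: "f (a\<^sup>\<star> * a) = of_real ((fnorm f a)\<^sup>2)"
    and fnorm_add: "fnorm f (a + b) \<le> fnorm f a + fnorm f b"
    and fnorm_scale: "fnorm f (c *\<^sub>C a) = cmod c * fnorm f a"
    and fnorm_minus: "fnorm f (a - b) = fnorm f (b - a)"
proof -
  interpret psd_form "\<lambda>a b. f (b\<^sup>\<star> * a)" by (rule positive_functional_psd_form[OF assms])
  have D: "D = fnorm f" by (simp add: fun_eq_iff D_def fnorm_def)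
  show "0 \<le> fnorm f a" "f (a\<^sup>\<star> * a) = of_real ((fnorm f a)\<^sup>2)"
    "fnorm f (a + b) \<le> fnorm f a + fnorm f b" "fnorm f (c *\<^sub>C a) = cmod c * fnorm f a"
    "fnorm f (a - b) = fnorm f (b - a)"
    using D_ge D_square D_add D_scale D_minus unfolding D by blast+
qed

lemma fnorm_le_iff:
  assumes "positive_functional f"
  shows "f (a\<^sup>\<star> * a) \<le> of_real (x\<^sup>2) \<longleftrightarrow> fnorm f a \<le> \<bar>x\<bar>"
  using fnorm_square[OF assms] fnorm_ge_zero[OF assms, of a]
    abs_le_square_iff[of "fnorm f a" x] by (simp add: less_eq_complex_def)

lemma pos_le_iff_fnorm_le:
  assumes "positive_functional h" "positive_functional g"
  shows "h \<preceq> g \<longleftrightarrow> (\<forall>a. fnorm h a \<le> fnorm g a)"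
  unfolding pos_le_def fnorm_square[OF assms(2)] fnorm_le_iff[OF assms(1)]
  using fnorm_ge_zero[OF assms(2)] by simp

lemma tendsto_zero_iff_fnorm:
  assumes "positive_functional f"
  shows "((\<lambda>x. f ((u x)\<^sup>\<star> * u x)) \<longlongrightarrow> 0) F \<longleftrightarrow> ((\<lambda>x. fnorm f (u x)) \<longlongrightarrow> 0) F"
proof
  assume "((\<lambda>x. f ((u x)\<^sup>\<star> * u x)) \<longlongrightarrow> 0) F"
  then have "((\<lambda>x. sqrt (Re (f ((u x)\<^sup>\<star> * u x)))) \<longlongrightarrow> sqrt (Re 0)) F"
    by (intro tendsto_intros)
  then show "((\<lambda>x. fnorm f (u x)) \<longlongrightarrow> 0) F" by (simp add: fnorm_def)
next
  assume "((\<lambda>x. fnorm f (u x)) \<longlongrightarrow> 0) F"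
  then have "((\<lambda>x. complex_of_real ((fnorm f (u x))\<^sup>2)) \<longlongrightarrow> of_real (0\<^sup>2)) F"
    by (intro tendsto_intros)
  then show "((\<lambda>x. f ((u x)\<^sup>\<star> * u x)) \<longlongrightarrow> 0) F" by (simp add: fnorm_square[OF assms])
qed

lemma abs_continuous_iff_fnorm:
  assumes f: "positive_functional f" and g: "positive_functional g"
  shows "g \<lless> f \<longleftrightarrow> (\<forall>a. (\<lambda>n. fnorm f (a n)) \<longlonglongrightarrow> 0 \<longrightarrow>
    (\<forall>e>0. \<exists>N. \<forall>m\<ge>N. \<forall>n\<ge>N. fnorm g (a m - a n) < e) \<longrightarrow> (\<lambda>n. fnorm g (a n)) \<longlonglongrightarrow> 0)"
proof -
  have "((\<lambda>(n, m). g ((a n - a m)\<^sup>\<star> * (a n - a m))) \<longlongrightarrow> 0) (sequentially \<times>\<^sub>F sequentially)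
      \<longleftrightarrow> (\<forall>e>0. \<exists>N. \<forall>m\<ge>N. \<forall>n\<ge>N. fnorm g (a m - a n) < e)" for a :: "nat \<Rightarrow> 'a"
  proof -
    have "((\<lambda>(n, m). g ((a n - a m)\<^sup>\<star> * (a n - a m))) \<longlongrightarrow> 0) (sequentially \<times>\<^sub>F sequentially)
      \<longleftrightarrow> ((\<lambda>(n, m). fnorm g (a n - a m)) \<longlongrightarrow> 0) (sequentially \<times>\<^sub>F sequentially)"
      using tendsto_zero_iff_fnorm[OF g, of "\<lambda>p. a (fst p) - a (snd p)" "sequentially \<times>\<^sub>F sequentially"]
      by (simp add: case_prod_unfold)
    also have "\<dots> \<longleftrightarrow> (\<forall>e>0. \<exists>N. \<forall>m\<ge>N. \<forall>n\<ge>N. fnorm g (a n - a m) < e)"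
      using fnorm_ge_zero[OF g]
      by (simp add: tendsto_iff eventually_prod_sequentially case_prod_unfold)
    also have "\<dots> \<longleftrightarrow> (\<forall>e>0. \<exists>N. \<forall>m\<ge>N. \<forall>n\<ge>N. fnorm g (a m - a n) < e)"
      by blast
    finally show ?thesis .
  qed
  then show ?thesis unfolding abs_continuous_def tendsto_zero_iff_fnorm[OF f] tendsto_zero_iff_fnorm[OF g]
    by simp
qed

text \<open>
  The \<open>h\<close>-seminorm of \<open>a\<close> is unchanged by subtracting an \<open>h\<close>-null sequence, up to an error tending
  to 0. Singularity and maximality of the decomposition use this with a sequence \<open>b\<close> whose images
  in the GNS space tend to the projection of the image of \<open>a\<close> onto the singular subspace.
\<close>

lemma fnorm_le_limit:
  assumes h: "positive_functional h" and hb: "(\<lambda>n. fnorm h (b n)) \<longlonglongrightarrow> 0"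
    and x: "\<And>n. fnorm h (a - b n) \<le> x n" "x \<longlonglongrightarrow> c"
  shows "fnorm h a \<le> c"
proof -
  have "(\<lambda>n. x n + fnorm h (b n)) \<longlonglongrightarrow> c + 0" by (intro tendsto_add x hb)
  moreover have "fnorm h a \<le> x n + fnorm h (b n)" for n
    using fnorm_add[OF h, of "a - b n" "b n"] x(1)[of n] by simp
  ultimately have "fnorm h a \<le> c + 0" by (intro LIMSEQ_le_const) auto
  then show ?thesis by simp
qed

lemma representable_imp_positive: "representable f \<Longrightarrow> positive_functional f"
  by (simp add: representable_def)

lemma representable_bounded:
  assumes "representable f"
  obtains K where "0 \<le> K" "\<And>a. cmod (f a) \<le> K * fnorm f a"
proof -
  note pos = representable_imp_positive[OF assms]
  obtain C where C: "0 \<le> C" "\<And>a. complex_of_real ((cmod (f a))\<^sup>2) \<le> complex_of_real C * f (a\<^sup>\<star> * a)"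
    using assms by (auto simp: representable_def)
  have "cmod (f a) \<le> sqrt C * fnorm f a" for a
  proof (rule power2_le_imp_le)
    show "(cmod (f a))\<^sup>2 \<le> (sqrt C * fnorm f a)\<^sup>2"
      using C(2)[of a] C(1) unfolding fnorm_square[OF pos]
      by (simp add: power_mult_distrib less_eq_complex_def)
  qed (simp add: C(1) fnorm_ge_zero[OF pos])
  with C(1) show ?thesis by (intro that[of "sqrt C"]) auto
qed

lemma representable_mult_bounded:
  assumes "representable f"
  obtains K where "0 \<le> K" "\<And>b. fnorm f (a * b) \<le> K * fnorm f b"
proof -
  note pos = representable_imp_positive[OF assms]
  obtain l where l: "0 \<le> l" "\<And>b. f (b\<^sup>\<star> * a\<^sup>\<star> * a * b) \<le> complex_of_real l * f (b\<^sup>\<star> * b)"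
    using assms unfolding representable_def by blast
  have "fnorm f (a * b) \<le> \<bar>sqrt l * fnorm f b\<bar>" for b
  proof -
    have "f ((a * b)\<^sup>\<star> * (a * b)) \<le> of_real ((sqrt l * fnorm f b)\<^sup>2)"
      using l(2)[of b] l(1) by (simp add: star_mult mult.assoc power_mult_distrib fnorm_square[OF pos])
    then show ?thesis by (simp only: fnorm_le_iff[OF pos])
  qed
  then show ?thesis using l(1) fnorm_ge_zero[OF pos] by (intro that[of "sqrt l"]) auto
qed

lemma representableI:
  assumes pos: "positive_functional f" and "0 \<le> K" "\<And>a. cmod (f a) \<le> K * fnorm f a"
    and L: "\<And>a. \<exists>L\<ge>0. \<forall>b. fnorm f (a * b) \<le> L * fnorm f b"
  shows "representable f"
  unfolding representable_def
proof (intro conjI allI pos)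
  have "complex_of_real ((cmod (f a))\<^sup>2) \<le> of_real (K\<^sup>2) * f (a\<^sup>\<star> * a)" for a
    using power_mono[OF assms(3)[of a], of 2] unfolding fnorm_square[OF pos]
    by (simp add: power_mult_distrib less_eq_complex_def)
  then show "\<exists>C\<ge>0. \<forall>a. complex_of_real ((cmod (f a))\<^sup>2) \<le> complex_of_real C * f (a\<^sup>\<star> * a)"
    by (intro exI[of _ "K\<^sup>2"]) auto
  fix a
  obtain M where M: "M \<ge> 0" "\<And>b. fnorm f (a * b) \<le> M * fnorm f b" using L by blast
  have "f (b\<^sup>\<star> * a\<^sup>\<star> * a * b) \<le> of_real (M\<^sup>2) * f (b\<^sup>\<star> * b)" for b
  proof -
    have "f ((a * b)\<^sup>\<star> * (a * b)) \<le> of_real ((M * fnorm f b)\<^sup>2)"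
      using M(1) M(2)[of b] fnorm_ge_zero[OF pos] by (simp only: fnorm_le_iff[OF pos])
    then show ?thesis by (simp add: star_mult mult.assoc power_mult_distrib fnorm_square[OF pos])
  qed
  then show "\<exists>l\<ge>0. \<forall>b. f (b\<^sup>\<star> * a\<^sup>\<star> * a * b) \<le> complex_of_real l * f (b\<^sup>\<star> * b)"
    by (intro exI[of _ "M\<^sup>2"]) auto
qed

section \<open>The GNS representation\<close>

locale gns =
  fixes g :: "'a::star_algebra \<Rightarrow> complex"
    and H :: "'h::complex_vector set" and ip :: "'h \<Rightarrow> 'h \<Rightarrow> complex"
    and J :: "('a \<Rightarrow> complex) \<Rightarrow> 'h"
  assumes representable: "representable g"
    and completion: "gns_completion g H ip J"
begin

abbreviation j :: "'a \<Rightarrow> 'h" where "j a \<equiv> J (gns_op g a)"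
abbreviation \<pi> :: "'a \<Rightarrow> 'h \<Rightarrow> 'h" where "\<pi> \<equiv> gns_rep g H ip J"
abbreviation \<zeta> :: 'h where "\<zeta> \<equiv> gns_vector g H ip J"

lemma positive: "positive_functional g"
  by (rule representable_imp_positive[OF representable])

sublocale dense_linear_map H ip j
proof -
  note lin = positive_functional_linear[OF positive]
  have "gns_op g (a + b) = gns_op g a + gns_op g b" "gns_op g (c *\<^sub>C a) = c *\<^sub>C gns_op g a" for a b c
    by (simp_all add: gns_op_def fun_eq_iff distrib_left mult_scaleC_right lin scaleC_fun_def
        scaleC_complex_def)
  with completion show "dense_linear_map H ip j"
    unfolding hilbert_completion_def dense_linear_map_def dense_linear_map_axioms_def by auto
qed

lemma ip_map: "ip (j a) (j b) = g (b\<^sup>\<star> * a)"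
  using completion gns_inner_gns_op[OF positive] by (simp add: hilbert_completion_def)

lemma nrm_map: "nrm (j a) = fnorm g a"
  by (simp add: ip_norm_def fnorm_def ip_map)

lemma
  shows cyclic_vector_mem [simp, intro]: "\<zeta> \<in> H"
    and cyclic_vector: "g a = ip (j a) \<zeta>"
proof -
  obtain K where "\<And>a. cmod (g a) \<le> K * fnorm g a"
    using representable_bounded[OF representable] by metis
  then have "\<exists>!z. z \<in> H \<and> (\<forall>a. g a = ip (j a) z)"
    by (intro riesz_on_dense_range) (simp_all add: positive_functional_linear[OF positive] nrm_map)
  from theI'[OF this] show "\<zeta> \<in> H" "g a = ip (j a) \<zeta>"
    unfolding gns_vector_def by blast+
qed

lemma
  shows rep_bounded_operator: "bounded_operator H ip (\<pi> x)"
    and rep_map: "\<pi> x (j a) = j (x * a)"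
proof -
  obtain K where K: "0 \<le> K" "\<And>a. fnorm g (x * a) \<le> K * fnorm g a"
    using representable_mult_bounded[OF representable] by blast
  then have "\<exists>!T. T \<in> extensional H \<and> bounded_operator H ip T \<and> (\<forall>a. T (j a) = j (x * a))"
    by (intro bounded_extension[where K = K])
      (simp_all add: distrib_left mult_scaleC_right map_add map_scale nrm_map)
  from theI'[OF this] show "bounded_operator H ip (\<pi> x)" "\<pi> x (j a) = j (x * a)"
    unfolding gns_rep_def by blast+
qed

lemma rep_mem [simp, intro]: "u \<in> H \<Longrightarrow> \<pi> x u \<in> H"
  and rep_add_vec: "\<lbrakk>u \<in> H; v \<in> H\<rbrakk> \<Longrightarrow> \<pi> x (u + v) = \<pi> x u + \<pi> x v"
  using rep_bounded_operator[of x] by (auto simp: bounded_operator_def)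

lemma rep_converges: "\<lbrakk>\<And>n. u n \<in> H; v \<in> H; u \<leadsto> v\<rbrakk> \<Longrightarrow> (\<lambda>n. \<pi> x (u n)) \<leadsto> \<pi> x v"
  by (rule bounded_operator_converges[OF rep_bounded_operator])

text \<open>
  On vectors \<open>j a\<close> both sides equal \<open>g (b\<^sup>\<star> x a)\<close>, and both are continuous in \<open>u\<close>. As the range of
  \<open>j\<close> is dense, this formula determines \<open>\<pi> x u\<close>; the algebraic properties of \<open>\<pi>\<close> follow by moving
  \<open>\<pi> x\<close> to the other side.
\<close>

lemma rep_adjoint_map:
  assumes "u \<in> H"
  shows "ip (\<pi> x u) (j b) = ip u (j (x\<^sup>\<star> * b))"
proof -
  obtain a where a: "(\<lambda>n. j (a n)) \<leadsto> u" using approximating_sequence assms by blast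
  have "(\<lambda>n. ip (\<pi> x (j (a n))) (j b)) \<longlonglongrightarrow> ip (\<pi> x u) (j b)"
    by (intro converges_ip rep_converges rep_mem a map_mem assms)
  moreover have "ip (\<pi> x (j (a n))) (j b) = ip (j (a n)) (j (x\<^sup>\<star> * b))" for n
    by (simp add: rep_map ip_map star_mult star_star mult.assoc)
  moreover have "(\<lambda>n. ip (j (a n)) (j (x\<^sup>\<star> * b))) \<longlonglongrightarrow> ip u (j (x\<^sup>\<star> * b))"
    by (intro converges_ip a map_mem assms)
  ultimately show ?thesis using LIMSEQ_unique by simp
qed

lemma rep_adjoint:
  assumes "u \<in> H" "v \<in> H"
  shows "ip (\<pi> x u) v = ip u (\<pi> (x\<^sup>\<star>) v)"
proof -
  obtain a where a: "(\<lambda>n. j (a n)) \<leadsto> v" using approximating_sequence assms by blast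
  have "(\<lambda>n. ip (\<pi> x u) (j (a n))) \<longlonglongrightarrow> ip (\<pi> x u) v"
    by (intro converges_ip_right rep_mem a map_mem assms)
  moreover have "ip (\<pi> x u) (j (a n)) = ip u (\<pi> (x\<^sup>\<star>) (j (a n)))" for n
    by (simp add: rep_map rep_adjoint_map assms)
  moreover have "(\<lambda>n. ip u (\<pi> (x\<^sup>\<star>) (j (a n)))) \<longlonglongrightarrow> ip u (\<pi> (x\<^sup>\<star>) v)"
    by (intro converges_ip_right rep_converges rep_mem a map_mem assms)
  ultimately show ?thesis using LIMSEQ_unique by simp
qed

lemma rep_add:
  assumes "u \<in> H"
  shows "\<pi> (x + y) u = \<pi> x u + \<pi> y u"
  using assms by (intro eq_if_ip_map_eq)
    (auto simp: ip_add_left rep_adjoint_map star_add distrib_right map_add ip_add_right)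

lemma rep_scale:
  assumes "u \<in> H"
  shows "\<pi> (c *\<^sub>C x) u = c *\<^sub>C \<pi> x u"
  using assms by (intro eq_if_ip_map_eq)
    (auto simp: ip_scaleC_left rep_adjoint_map star_scaleC mult_scaleC_left map_scale ip_scale_right)

lemma rep_mult:
  assumes "u \<in> H"
  shows "\<pi> (x * y) u = \<pi> x (\<pi> y u)"
  using assms by (intro eq_if_ip_map_eq) (auto simp: rep_adjoint_map star_mult mult.assoc)

text \<open>
  The vector \<open>\<zeta>\<close> takes the role of the class of a unit, even if the algebra has none: paired
  with \<open>j b\<close>, both sides give \<open>g (b\<^sup>\<star> x)\<close>.
\<close>

lemma rep_cyclic_vector: "\<pi> x \<zeta> = j x"
proof (rule eq_if_ip_map_eq)
  fix b
  have "ip (\<pi> x \<zeta>) (j b) = cnj (g (x\<^sup>\<star> * b))"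
    using rep_adjoint_map[of \<zeta> x b] ip_commute[of \<zeta> "j (x\<^sup>\<star> * b)"] by (simp add: cyclic_vector)
  also have "\<dots> = ip (j x) (j b)" using ip_commute[of "j x" "j b"] by (simp add: ip_map)
  finally show "ip (\<pi> x \<zeta>) (j b) = ip (j x) (j b)" .
qed auto

definition vector_functional :: "'h \<Rightarrow> 'a \<Rightarrow> complex" where
  "vector_functional u a = ip (\<pi> a u) u"

lemma vector_functional_square:
  assumes "u \<in> H"
  shows "vector_functional u (a\<^sup>\<star> * a) = of_real ((nrm (\<pi> a u))\<^sup>2)"
proof -
  have "vector_functional u (a\<^sup>\<star> * a) = ip (\<pi> (a\<^sup>\<star>) (\<pi> a u)) u"
    by (simp only: vector_functional_def rep_mult[OF assms])
  also have "\<dots> = ip (\<pi> a u) (\<pi> a u)"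
    by (simp only: rep_adjoint[OF rep_mem[OF assms] assms] star_star)
  also have "\<dots> = of_real ((nrm (\<pi> a u))\<^sup>2)" by (rule ip_self[OF rep_mem[OF assms]])
  finally show ?thesis .
qed

lemma fnorm_vector_functional: "u \<in> H \<Longrightarrow> fnorm (vector_functional u) a = nrm (\<pi> a u)"
  using nrm_ge_zero[of "\<pi> a u"] by (simp add: fnorm_def vector_functional_square)

text \<open>
  All conditions follow from \<open>fnorm_vector_functional\<close>: the first bound is the Cauchy-Schwarz
  inequality, the second is the boundedness of \<open>\<pi> a\<close>.
\<close>

lemma representable_vector_functional:
  assumes u: "u \<in> H"
  shows "representable (vector_functional u)"
proof (rule representableI)
  show "positive_functional (vector_functional u)"
  proof (rule positive_functionalI)
    show "0 \<le> vector_functional u (a\<^sup>\<star> * a)" for a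
      by (simp add: vector_functional_square u less_eq_complex_def)
  qed (use u in \<open>auto simp: vector_functional_def rep_add rep_scale ip_add_left ip_scaleC_left\<close>)
  show "cmod (vector_functional u a) \<le> nrm u * fnorm (vector_functional u) a" for a
    using cauchy_schwarz[of "\<pi> a u" u] u
    by (simp add: fnorm_vector_functional) (simp add: vector_functional_def mult.commute)
  fix a
  obtain K where K: "\<forall>v\<in>H. nrm (\<pi> a v) \<le> K * nrm v"
    using rep_bounded_operator[of a] unfolding bounded_operator_def by blast
  have "nrm (\<pi> a v) \<le> \<bar>K\<bar> * nrm v" if v: "v \<in> H" for v
    using order_trans[OF bspec[OF K v] mult_right_mono[OF abs_ge_self nrm_ge_zero[OF v]]] .
  then show "\<exists>L\<ge>0. \<forall>b. fnorm (vector_functional u) (a * b) \<le> L * fnorm (vector_functional u) b"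
    using u by (intro exI[of _ "\<bar>K\<bar>"]) (auto simp: fnorm_vector_functional rep_mult)
qed (rule nrm_ge_zero[OF u])

end

section \<open>The Lebesgue decomposition\<close>

locale lebesgue_decomposition = gns g H ip J
  for g :: "'a::star_algebra \<Rightarrow> complex"
    and H :: "'h::complex_vector set" and ip :: "'h \<Rightarrow> 'h \<Rightarrow> complex"
    and J :: "('a \<Rightarrow> complex) \<Rightarrow> 'h" +
  fixes f :: "'a \<Rightarrow> complex"
  assumes representable_f: "representable f"
begin

abbreviation \<MM> :: "'h set" where "\<MM> \<equiv> sing_subspace f g H ip J"
abbreviation P :: "'h \<Rightarrow> 'h" where "P \<equiv> orth_projection \<MM> ip"

lemma positive_f: "positive_functional f"
  by (rule representable_imp_positive[OF representable_f])

lemma sing_subspace_eq: "\<MM> = null_limits (fnorm f)"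
  by (simp add: sing_subspace_def null_limits_def converges_def gns_inner_gns_op[OF positive_f]
      tendsto_zero_iff_fnorm[OF positive_f])

lemma sing_subspace_closed: "closed_subspace \<MM>"
  unfolding sing_subspace_eq
  by (rule null_limits_closed_subspace)
    (simp add: seminorm_def fnorm_ge_zero fnorm_add fnorm_scale positive_f)

lemma sing_subspace_mem: "u \<in> \<MM> \<Longrightarrow> u \<in> H"
  by (simp add: sing_subspace_def)

lemma proj_mem: "u \<in> H \<Longrightarrow> P u \<in> \<MM>"
  by (rule orth_projection_mem[OF sing_subspace_closed])

lemma proj_orth: "u \<in> H \<Longrightarrow> m \<in> \<MM> \<Longrightarrow> ip (u - P u) m = 0"
  by (rule orth_projection_orth[OF sing_subspace_closed])

lemma proj_in_H [simp, intro]: "u \<in> H \<Longrightarrow> P u \<in> H"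
  by (rule sing_subspace_mem[OF proj_mem])

text \<open>
  Left multiplication by \<open>x\<close> is bounded for the seminorm of \<open>f\<close>, so it preserves
  \<open>f\<close>-null sequences, while \<open>\<pi> x\<close> is continuous.
\<close>

lemma rep_sing_subspace:
  assumes "u \<in> \<MM>"
  shows "\<pi> x u \<in> \<MM>"
proof -
  obtain a where a: "(\<lambda>n. fnorm f (a n)) \<longlonglongrightarrow> 0" "(\<lambda>n. j (a n)) \<leadsto> u"
    using assms by (auto simp: sing_subspace_eq null_limits_def)
  obtain K where K: "0 \<le> K" "\<And>b. fnorm f (x * b) \<le> K * fnorm f b"
    using representable_mult_bounded[OF representable_f] by blast
  have "(\<lambda>n. fnorm f (x * a n)) \<longlonglongrightarrow> 0"
    by (rule tendsto_sandwich[OF _ _ tendsto_const tendsto_mult_right_zero[OF a(1), of K]])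
      (simp_all add: K(2) fnorm_ge_zero[OF positive_f])
  moreover have "(\<lambda>n. j (x * a n)) \<leadsto> \<pi> x u"
    using rep_converges[OF _ _ a(2), of x] sing_subspace_mem[OF assms] by (simp add: rep_map)
  ultimately show ?thesis
    using sing_subspace_mem[OF assms] by (auto simp: sing_subspace_eq null_limits_def)
qed

text \<open>
  Invariance of \<open>\<MM>\<close> under \<open>\<pi> x\<close> and under its adjoint \<open>\<pi> (x\<^sup>\<star>)\<close> makes the orthogonal complement
  invariant too, so \<open>P\<close> commutes with the representation.
\<close>

lemma rep_proj:
  assumes u: "u \<in> H"
  shows "\<pi> x (P u) = P (\<pi> x u)" and "\<pi> x (u - P u) = \<pi> x u - P (\<pi> x u)"
proof -
  have add: "\<pi> x u = \<pi> x (P u) + \<pi> x (u - P u)"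
    using u rep_add_vec[of "P u" "u - P u" x] by simp
  have "P (\<pi> x u) = \<pi> x (P u)"
  proof (rule orth_projection_eqI[OF sing_subspace_closed])
    show "\<pi> x (P u) \<in> \<MM>" by (intro rep_sing_subspace proj_mem u)
    show "ip (\<pi> x u - \<pi> x (P u)) m = 0" if m: "m \<in> \<MM>" for m
    proof -
      have "ip (\<pi> x (u - P u)) m = ip (u - P u) (\<pi> (x\<^sup>\<star>) m)"
        using u sing_subspace_mem[OF m] by (intro rep_adjoint) auto
      also have "\<dots> = 0" by (intro proj_orth u rep_sing_subspace m)
      finally show ?thesis by (simp add: add)
    qed
  qed (use u in auto)
  with add show "\<pi> x (P u) = P (\<pi> x u)" "\<pi> x (u - P u) = \<pi> x u - P (\<pi> x u)" by simp_all
qed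

lemma sing_part_eq: "sing_part f g H ip J = vector_functional (P \<zeta>)"
  and ac_part_eq: "ac_part f g H ip J = vector_functional (\<zeta> - P \<zeta>)"
  by (simp_all add: fun_eq_iff sing_part_def ac_part_def vector_functional_def Let_def)

text \<open>
  These two formulas, obtained from \<open>\<pi> a \<zeta> = j a\<close> and from \<open>P\<close> commuting with \<open>\<pi> a\<close>, turn the
  claims about the two parts into statements about the distance of \<open>j a\<close> from \<open>\<MM>\<close>.
\<close>

lemma fnorm_sing_part: "fnorm (sing_part f g H ip J) a = nrm (P (j a))"
  by (simp add: sing_part_eq fnorm_vector_functional rep_proj rep_cyclic_vector)

lemma fnorm_ac_part: "fnorm (ac_part f g H ip J) a = nrm (j a - P (j a))"
  by (simp add: ac_part_eq fnorm_vector_functional rep_proj rep_cyclic_vector)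

lemma representable_parts:
  "representable (ac_part f g H ip J)" "representable (sing_part f g H ip J)"
  unfolding ac_part_eq sing_part_eq by (intro representable_vector_functional; simp)+

text \<open>
  The mixed terms vanish because \<open>\<pi> a\<close> preserves both \<open>\<MM>\<close> and its orthogonal complement.
\<close>

lemma sum_parts: "g a = ac_part f g H ip J a + sing_part f g H ip J a"
proof -
  have "ip (\<pi> a (\<zeta> - P \<zeta>)) (P \<zeta>) = 0"
    using proj_orth[OF map_mem proj_mem[OF cyclic_vector_mem], of a]
    by (simp add: rep_proj rep_cyclic_vector)
  moreover have "ip (\<pi> a (P \<zeta>)) (\<zeta> - P \<zeta>) = 0"
  proof -
    have "ip (\<zeta> - P \<zeta>) (\<pi> a (P \<zeta>)) = 0" by (intro proj_orth rep_sing_subspace proj_mem) simp_all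
    then show ?thesis using ip_commute[of "\<pi> a (P \<zeta>)" "\<zeta> - P \<zeta>"] by simp
  qed
  moreover have "j a = \<pi> a (\<zeta> - P \<zeta>) + \<pi> a (P \<zeta>)"
    using rep_add_vec[of "\<zeta> - P \<zeta>" "P \<zeta>" a] by (simp add: rep_cyclic_vector)
  then have "g a = ip (\<pi> a (\<zeta> - P \<zeta>) + \<pi> a (P \<zeta>)) ((\<zeta> - P \<zeta>) + P \<zeta>)"
    by (simp add: cyclic_vector)
  moreover have "ip (u + v) (w + z) = ip u w + ip u z + (ip v w + ip v z)"
    if "u \<in> H" "v \<in> H" "w \<in> H" "z \<in> H" for u v w z
    using that by (simp add: ip_add_left ip_add_right)
  ultimately show ?thesis
    by (simp only: ac_part_eq sing_part_eq vector_functional_def cyclic_vector_mem rep_mem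
        mem_diff proj_in_H) simp
qed

lemma proj_approximating_sequence:
  assumes "u \<in> H"
  obtains b where "(\<lambda>n. fnorm f (b n)) \<longlonglongrightarrow> 0" "(\<lambda>n. j (b n)) \<leadsto> P u"
  using proj_mem[OF assms] by (auto simp: sing_subspace_eq null_limits_def)

text \<open>
  Let \<open>a\<^sub>n\<close> be \<open>f\<close>-null with \<open>j a\<^sub>n - P (j a\<^sub>n)\<close> fundamental, with limit \<open>w\<close> orthogonal to \<open>\<MM>\<close>.
  Approximating \<open>P (j a\<^sub>n)\<close>, a point of \<open>\<MM>\<close>, by some \<open>j b\<close> with \<open>b\<close> small for \<open>f\<close> shows that
  \<open>j (a\<^sub>n - b)\<close> is close to \<open>w\<close>. So \<open>w\<close> also lies in \<open>\<MM>\<close>, hence \<open>w = 0\<close>.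
\<close>

lemma ac_part_abs_continuous: "ac_part f g H ip J \<lless> f"
proof -
  have "(\<lambda>n. nrm (j (a n) - P (j (a n)))) \<longlonglongrightarrow> 0"
    if a: "(\<lambda>n. fnorm f (a n)) \<longlonglongrightarrow> 0"
      and cau: "\<forall>e>0. \<exists>N. \<forall>m\<ge>N. \<forall>n\<ge>N. fnorm (ac_part f g H ip J) (a m - a n) < e"
    for a
  proof -
    define v where "v n = j (a n) - P (j (a n))" for n
    have vH: "v n \<in> H" for n by (simp add: v_def)
    have orth: "ip (v n) m = 0" if "m \<in> \<MM>" for n m
      using proj_orth[OF _ that] by (simp add: v_def)
    have v_diff: "j (a m - a n) - P (j (a m - a n)) = v m - v n" for m n
      by (simp add: v_def map_diff orth_projection_diff sing_subspace_closed)
    have "fundamental v"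
      unfolding fundamental_def using cau by (simp add: fnorm_ac_part v_diff)
    then obtain w where w: "w \<in> H" "v \<leadsto> w" using fundamental_converges vH by blast
    have "ip w m = 0" if m: "m \<in> \<MM>" for m
      using converges_ip[OF vH w(1) sing_subspace_mem[OF m] w(2)] orth[OF m]
      by (simp add: LIMSEQ_const_iff)
    moreover have "w \<in> \<MM>"
      unfolding sing_subspace_eq
    proof (rule null_limitsI)
      fix e :: real assume "e > 0"
      then have e: "e / 2 > 0" by simp
      have "\<forall>\<^sub>F n in sequentially. fnorm f (a n) < e / 2 \<and> nrm (v n - w) < e / 2"
        using order_tendstoD(2)[OF a e] order_tendstoD(2)[OF w(2)[unfolded converges_def] e]
        by (rule eventually_conj)
      then obtain n where n: "fnorm f (a n) < e / 2" "nrm (v n - w) < e / 2"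
        using eventually_happens'[OF sequentially_bot] by blast
      obtain b where b: "fnorm f b < e / 2" "nrm (j b - P (j (a n))) < e / 2"
        using null_limitsD[OF _ e] proj_mem[OF map_mem, of "a n"] unfolding sing_subspace_eq by blast
      have "fnorm f (a n - b) < e"
        using fnorm_add[OF positive_f, of "a n" "- b"] fnorm_minus[OF positive_f, of 0 b] n b by simp
      moreover have "nrm (j (a n - b) - w) < e"
        using nrm_tri[of "j (a n - b)" "v n" w] nrm_minus[of "P (j (a n))" "j b"] vH w n b
        by (simp add: v_def map_diff)
      ultimately show "\<exists>c. fnorm f c < e \<and> nrm (j c - w) < e" by blast
    qed (use w fnorm_ge_zero[OF positive_f] in auto)
    ultimately have "w = 0" using ip_eq_zero w(1) by blast
    with w(2) show ?thesis by (simp add: converges_def v_def)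
  qed
  then show ?thesis
    unfolding abs_continuous_iff_fnorm[OF positive_f representable_imp_positive[OF representable_parts(1)]]
      fnorm_ac_part by blast
qed

text \<open>
  Take \<open>b\<close> an \<open>f\<close>-null sequence with \<open>j (b n)\<close> tending to \<open>P (j a)\<close>. It is \<open>h\<close>-null as \<open>h \<preceq> f\<close>, and
  \<open>a - b n\<close> tends to 0 in the seminorm of \<open>h\<close> as \<open>h\<close> lies below the singular part.
\<close>

lemma sing_part_singular: "mutually_singular (sing_part f g H ip J) f"
  unfolding mutually_singular_def
proof (intro allI impI)
  fix h :: "'a \<Rightarrow> complex"
  assume h: "representable h" and "h \<preceq> sing_part f g H ip J" "h \<preceq> f"
  note pos = representable_imp_positive[OF h]
  have le_s: "fnorm h a \<le> nrm (P (j a))" and le_f: "fnorm h a \<le> fnorm f a" for a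
    using \<open>h \<preceq> sing_part f g H ip J\<close> \<open>h \<preceq> f\<close>
      pos_le_iff_fnorm_le[OF pos representable_imp_positive[OF representable_parts(2)]]
      pos_le_iff_fnorm_le[OF pos positive_f] by (simp_all add: fnorm_sing_part)
  have zero: "fnorm h a \<le> 0" for a
  proof -
    obtain b where b: "(\<lambda>n. fnorm f (b n)) \<longlonglongrightarrow> 0" "(\<lambda>n. j (b n)) \<leadsto> P (j a)"
      using proj_approximating_sequence by blast
    show ?thesis
    proof (rule fnorm_le_limit[OF pos, where b = b])
      show "(\<lambda>n. fnorm h (b n)) \<longlonglongrightarrow> 0"
        by (rule tendsto_sandwich[OF _ _ tendsto_const b(1)]) (simp_all add: le_f fnorm_ge_zero[OF pos])
      show "(\<lambda>n. nrm (j (b n) - P (j a))) \<longlonglongrightarrow> 0" using b(2) by (simp add: converges_def)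
      show "fnorm h (a - b n) \<le> nrm (j (b n) - P (j a))" for n
      proof -
        have "nrm (P (j (a - b n))) = nrm (P (P (j a) - j (b n)))"
          using proj_mem[OF map_mem]
          by (simp add: map_diff orth_projection_diff orth_projection_of_mem sing_subspace_closed)
        also have "\<dots> \<le> nrm (P (j a) - j (b n))"
          by (intro nrm_orth_projection_le sing_subspace_closed) auto
        finally show ?thesis using le_s[of "a - b n"] nrm_minus[of "P (j a)" "j (b n)"] by simp
      qed
    qed
  qed
  obtain K where K: "\<And>a. cmod (h a) \<le> K * fnorm h a" using representable_bounded[OF h] by blast
  have "h a = 0" for a
    using K[of a] zero[of a] fnorm_ge_zero[OF pos, of a] by simp
  then show "h = 0" by (simp add: fun_eq_iff)
qed

text \<open>
  Take \<open>b\<close> as for singularity. It is fundamental for \<open>g\<close>, hence for \<open>h\<close>, so absolute continuity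
  makes it \<open>h\<close>-null. Now \<open>h \<preceq> g\<close> bounds the seminorm of \<open>a - b n\<close> by the distance of \<open>j a\<close> and
  \<open>j (b n)\<close>, which tends to that of \<open>j a\<close> and \<open>P (j a)\<close>.
\<close>

lemma ac_part_maximal:
  assumes h: "representable h" and "h \<preceq> g" and ac: "h \<lless> f"
  shows "h \<preceq> ac_part f g H ip J"
proof -
  note pos = representable_imp_positive[OF h]
  have le: "fnorm h a \<le> nrm (j a)" for a
    using \<open>h \<preceq> g\<close> pos_le_iff_fnorm_le[OF pos positive] by (simp add: nrm_map)
  have "fnorm h a \<le> nrm (j a - P (j a))" for a
  proof -
    obtain b where b: "(\<lambda>n. fnorm f (b n)) \<longlonglongrightarrow> 0" "(\<lambda>n. j (b n)) \<leadsto> P (j a)"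
      using proj_approximating_sequence by blast
    have "\<exists>N. \<forall>m\<ge>N. \<forall>n\<ge>N. fnorm h (b m - b n) < e" if e: "e > 0" for e
    proof -
      have "fundamental (\<lambda>n. j (b n))" by (rule converges_fundamental[OF _ _ b(2)]) auto
      then obtain N where "\<forall>m\<ge>N. \<forall>n\<ge>N. nrm (j (b m - b n)) < e"
        using e unfolding fundamental_def map_diff by blast
      then show ?thesis using le le_less_trans by blast
    qed
    then have hb: "(\<lambda>n. fnorm h (b n)) \<longlonglongrightarrow> 0"
      using ac b(1) unfolding abs_continuous_iff_fnorm[OF positive_f pos] by blast
    show ?thesis
    proof (rule fnorm_le_limit[OF pos hb])
      show "fnorm h (a - b n) \<le> nrm (j a - j (b n))" for n using le[of "a - b n"] by (simp add: map_diff)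
      show "(\<lambda>n. nrm (j a - j (b n))) \<longlonglongrightarrow> nrm (j a - P (j a))"
        by (intro converges_nrm converges_diff converges_const b) auto
    qed
  qed
  then show ?thesis
    unfolding pos_le_iff_fnorm_le[OF pos representable_imp_positive[OF representable_parts(1)]]
      fnorm_ac_part by blast
qed

end

theorem theorem3p3:
  fixes f g :: "'a::star_algebra \<Rightarrow> complex"
    and H :: "'h::complex_vector set" and ip :: "'h \<Rightarrow> 'h \<Rightarrow> complex"
    and J :: "('a \<Rightarrow> complex) \<Rightarrow> 'h"
  assumes "representable f" and "representable g"
    and "gns_completion g H ip J"
  shows "g = ac_part f g H ip J + sing_part f g H ip J \<and>
    representable (ac_part f g H ip J) \<and>
    representable (sing_part f g H ip J) \<and>
    ac_part f g H ip J \<lless> f \<and>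
    mutually_singular (sing_part f g H ip J) f \<and>
    (\<forall>h. representable h \<longrightarrow> h \<preceq> g \<longrightarrow> h \<lless> f \<longrightarrow> h \<preceq> ac_part f g H ip J)"
proof -
  interpret lebesgue_decomposition g H ip J f using assms by unfold_locales
  show ?thesis
    using sum_parts representable_parts ac_part_abs_continuous sing_part_singular ac_part_maximal
    by (simp add: fun_eq_iff)
qed

end
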